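(* Let $F>2$, let $W=(H,Q)$ be an $X$-periodic roll wave of the inviscid Saint-Venant equations with speed $c$ and let $\Delta(\lambda,\xi)=\lambda\hat\Delta(\lambda,\xi)$ be its periodic Evans-Lopatinsky determinant. Assume that $0$ is a double root (multiplicity exactly two) of $\Delta(\cdot,0)$. Then the characteristics, at the wave $W$, of the Whitham modulation system $\partial_t\overline{H}+\partial_x\overline{Q}=0$, $\partial_t k-\partial_x\omega=0$ are given by the values $c+\alpha$ and $c$, where $$\alpha=\frac{\partial_\xi\hat\Delta(0,0)}{i\,\partial_\lambda\hat\Delta(0,0)};$$ or, after the change $x\to x-ct$ to comoving coordinates, by the first-order coefficients $\alpha$ and $0$ of $\lambda_1$ and $\lambda_2$, respectively, where $\lambda_1(\xi)=-i\xi\alpha+O(\xi^2)$ and $\lambda_2(\xi)\equiv0$ are the two roots of $\Delta(\cdot,\xi)$ near $0$ for $\xi$ near $0$.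
   Context: Equations. The inviscid Saint-Venant equations are $\partial_t h+\partial_x q=0$, $\partial_t q+\partial_x\big(\tfrac{q^2}{h}+\tfrac{h^2}{2F^2}\big)=h-\tfrac{|q|q}{h^2}$, with Froude number $F$. Roll waves. Fix $F>2$. A roll wave is determined by $H_s>0$ and $H_-$ with $\frac{1+2F+\sqrt{1+4F}}{2F^2}H_s<H_-<H_s$. Put $q_0=H_s^{3/2}/F$, $c=H_s^{1/2}(1+1/F)$, and let $H_+>H_s$ be the unique solution of $\frac{q_0^2}{H_+}+\frac{H_+^2}{2F^2}=\frac{q_0^2}{H_-}+\frac{H_-^2}{2F^2}$. Let $H:[0,X]\to[H_-,H_+]$ be the (increasing) solution of $H'=F^2\,\frac{H^2+(H_s-c^2)H+q_0^2/H_s}{H^2+H_sH+H_s^2}$ with $H(0)=H_-$, where $X>0$ is determined by $H(X)=H_+$, and let $Q=cH-q_0$. The $X$-periodic extension of $(H,Q)|_{(0,X)}$, with shocks at $jX$, $j\in\mathbb{Z}$, is the profile $W$, and $(h,q)(x,t)=(H,Q)(x-ct)$ is the roll wave. Let $x_s\in(0,X)$ be the sonic point, where $H(x_s)=H_s$. Interior eigenvalue equations. For $\lambda\in\mathbb{C}$, consider on $(0,X)$ $$\lambda h+\partial_x(-ch+q)=0,\qquad \lambda q+\partial_x\Big(\big(\tfrac{2Q}{H}-c\big)q+\big(-\tfrac{Q^2}{H^2}+\tfrac{H}{F^2}\big)h\Big)=h-\tfrac{2Q}{H^2}q+\tfrac{2Q^2}{H^3}h.$$ This system is singular at $x_s$.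 For $\Re(\lambda)>-\tfrac{F-2}{2\sqrt{H_s}}$ its space of analytic solutions on the closed cell is one-dimensional; $(h,q)=(h,q)(\cdot;\lambda)$ denotes the analytic solution (depending analytically on $\lambda$) normalized by $$\begin{pmatrix}h\\ q\end{pmatrix}(x_s)=\frac{F-2}{2(F+1)}\sqrt{H_s}\begin{pmatrix}\big(\lambda+\tfrac23\tfrac{F+1}{\sqrt{H_s}}\big)F\\ \lambda\sqrt{H_s}(F-1)+\tfrac23(F+1)^2\end{pmatrix}.$$ Evans-Lopatinsky determinant. For $\Re(\lambda)>-\tfrac{F-2}{2\sqrt{H_s}}$ and $\xi\in[-\pi/X,\pi/X]$, with $\{f\}:=f(X^-)-f(0^+)$ and $\{f\}_\xi:=f(X^-)-e^{i\xi X}f(0^+)$, $$\Delta(\lambda,\xi):=\det\begin{pmatrix}\{\lambda H\}&\{-ch+q\}_\xi\\ \{\lambda Q-(H-\tfrac{Q^2}{H^2})\}&\{(-\tfrac{Q^2}{H^2}+\tfrac{H}{F^2})h+(\tfrac{2Q}{H}-c)q\}_\xi\end{pmatrix}.$$ One has $\Delta(0,\xi)=0$ for all $\xi$, and $\hat\Delta$ is the analytic function with $\Delta(\lambda,\xi)=\lambda\hat\Delta(\lambda,\xi)$. The root $0$ of $\Delta(\cdot,0)$ has multiplicity exactly two iff $\partial_\lambda\hat\Delta(0,0)\neq0$. Whitham system. For fixed $F$, let $\overline{H}=\frac1X\int_0^X H\,dx$, $\overline{Q}=\frac1X\int_0^XQ\,dx=c\overline{H}-q_0$, $k=1/X$,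 $\omega=-kc$, all viewed as functions of the wave parameters $(H_s,H_-)$. The Whitham system is $\partial_tG^0+\partial_xG^1=0$ with $G^0=(\overline{H},k)$, $G^1=(\overline{Q},-\omega)$. With $A^j=d_{(H_s,H_-)}G^j$ evaluated at the wave, its characteristics are the eigenvalues of $(A^0)^{-1}A^1$. The change to comoving coordinates shifts each characteristic by $-c$. *)

theory Defs
  imports "HOL-Complex_Analysis.Complex_Analysis" "HOL-Library.Landau_Symbols"
begin

text \<open>
  Throughout, \<open>F\<close> is the Froude number and a roll wave is parametrized by \<open>(Hs, Hm)\<close>, the fluid
  height at the sonic point and the minimal height.
\<close>

definition wave_params :: "real \<Rightarrow> real \<Rightarrow> real \<Rightarrow> bool" where
  "wave_params F Hs Hm \<longleftrightarrow>
     Hs > 0 \<and> (1 + 2*F + sqrt (1 + 4*F)) / (2*F^2) * Hs < Hm \<and> Hm < Hs"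

definition q0 :: "real \<Rightarrow> real \<Rightarrow> real" where
  "q0 F Hs = Hs powr (3/2) / F"

definition speed :: "real \<Rightarrow> real \<Rightarrow> real" where
  "speed F Hs = sqrt Hs * (1 + 1/F)"

definition roll_wave ::
  "real \<Rightarrow> real \<Rightarrow> real \<Rightarrow> real \<Rightarrow> real \<Rightarrow> (real \<Rightarrow> real) \<Rightarrow> bool" where
  "roll_wave F Hs Hm Hp X H \<longleftrightarrow>
     wave_params F Hs Hm \<and>
     Hp > Hs \<and>
     (q0 F Hs)^2 / Hp + Hp^2 / (2*F^2) = (q0 F Hs)^2 / Hm + Hm^2 / (2*F^2) \<and>
     X > 0 \<and> H 0 = Hm \<and> H X = Hp \<and> H ` {0..X} \<subseteq> {Hm..Hp} \<and> strict_mono_on {0..X} H \<and>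
     (\<forall>x\<in>{0..X}. (H has_real_derivative
         F^2 * ((H x)^2 + (Hs - (speed F Hs)^2) * H x + (q0 F Hs)^2 / Hs)
             / ((H x)^2 + Hs * H x + Hs^2)) (at x within {0..X}))"

definition discharge :: "real \<Rightarrow> real \<Rightarrow> (real \<Rightarrow> real) \<Rightarrow> real \<Rightarrow> real" where
  "discharge F Hs H x = speed F Hs * H x - q0 F Hs"

text \<open>The two components of the linearized flux, in the frame moving with the wave.\<close>

definition lin_flux1 ::
  "real \<Rightarrow> real \<Rightarrow> (real \<Rightarrow> complex) \<Rightarrow> (real \<Rightarrow> complex) \<Rightarrow> real \<Rightarrow> complex" where
  "lin_flux1 F Hs h q x = - of_real (speed F Hs) * h x + q x"

definition lin_flux2 ::
  "real \<Rightarrow> real \<Rightarrow> (real \<Rightarrow> real) \<Rightarrow> (real \<Rightarrow> complex) \<Rightarrow> (real \<Rightarrow> complex) \<Rightarrow> real \<Rightarrow> complex" where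
  "lin_flux2 F Hs H h q x =
     (let Q = discharge F Hs H in
      of_real (2 * Q x / H x - speed F Hs) * q x
      + of_real (- ((Q x)^2 / (H x)^2) + H x / F^2) * h x)"

definition eigenvalue_system ::
  "real \<Rightarrow> real \<Rightarrow> real \<Rightarrow> (real \<Rightarrow> real) \<Rightarrow> complex \<Rightarrow> (real \<Rightarrow> complex) \<Rightarrow> (real \<Rightarrow> complex) \<Rightarrow> bool" where
  "eigenvalue_system F Hs X H lam h q \<longleftrightarrow>
     (\<forall>x\<in>{0<..<X}. let Q = discharge F Hs H in
        lin_flux1 F Hs h q differentiable (at x) \<and>
        lam * h x + vector_derivative (lin_flux1 F Hs h q) (at x) = 0 \<and>
        lin_flux2 F Hs H h q differentiable (at x) \<and>
        lam * q x + vector_derivative (lin_flux2 F Hs H h q) (at x)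
          = h x - of_real (2 * Q x / (H x)^2) * q x + of_real (2 * (Q x)^2 / (H x)^3) * h x)"

text \<open>
  Real-analyticity on the closed cell \<open>[0,X]\<close> (endpoints and sonic point included): the function
  is the restriction of a function holomorphic in a complex neighbourhood of the cell.
\<close>

definition analytic_on_cell :: "real \<Rightarrow> (real \<Rightarrow> complex) \<Rightarrow> bool" where
  "analytic_on_cell X f \<longleftrightarrow>
     (\<exists>g. g analytic_on (complex_of_real ` {0..X}) \<and> (\<forall>x\<in>{0..X}. f x = g (of_real x)))"

definition spectral_domain :: "real \<Rightarrow> real \<Rightarrow> complex set" where
  "spectral_domain F Hs = {lam. Re lam > - (F - 2) / (2 * sqrt Hs)}"

text \<open>
  The first argument of \<open>h\<close> and \<open>q\<close> is the spectral parameter. Analytic dependence on it is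
  understood for the sup norm on the closed cell, i.e. holomorphy at each fixed point
  together with joint continuity.
\<close>

definition normalized_solutions ::
  "real \<Rightarrow> real \<Rightarrow> real \<Rightarrow> (real \<Rightarrow> real) \<Rightarrow> real \<Rightarrow>
     (complex \<Rightarrow> real \<Rightarrow> complex) \<Rightarrow> (complex \<Rightarrow> real \<Rightarrow> complex) \<Rightarrow> bool" where
  "normalized_solutions F Hs X H xs h q \<longleftrightarrow>
     (\<forall>lam\<in>spectral_domain F Hs.
        analytic_on_cell X (h lam) \<and> analytic_on_cell X (q lam) \<and>
        eigenvalue_system F Hs X H lam (h lam) (q lam) \<and>
        h lam xs = of_real ((F - 2) / (2 * (F + 1)) * sqrt Hs)
                   * ((lam + of_real (2/3 * (F + 1) / sqrt Hs)) * of_real F) \<and>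
        q lam xs = of_real ((F - 2) / (2 * (F + 1)) * sqrt Hs)
                   * (lam * of_real (sqrt Hs * (F - 1)) + of_real (2/3 * (F + 1)^2))) \<and>
     (\<forall>x\<in>{0..X}. (\<lambda>lam. h lam x) holomorphic_on spectral_domain F Hs \<and>
                 (\<lambda>lam. q lam x) holomorphic_on spectral_domain F Hs) \<and>
     continuous_on (spectral_domain F Hs \<times> {0..X}) (\<lambda>(lam, x). h lam x) \<and>
     continuous_on (spectral_domain F Hs \<times> {0..X}) (\<lambda>(lam, x). q lam x)"

definition jump :: "real \<Rightarrow> (real \<Rightarrow> complex) \<Rightarrow> complex" where
  "jump X f = Lim (at_left X) f - Lim (at_right 0) f"

definition bloch_jump :: "real \<Rightarrow> real \<Rightarrow> (real \<Rightarrow> complex) \<Rightarrow> complex" where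
  "bloch_jump X xi f = Lim (at_left X) f - exp (\<i> * of_real (xi * X)) * Lim (at_right 0) f"

definition evans_lopatinsky ::
  "real \<Rightarrow> real \<Rightarrow> real \<Rightarrow> (real \<Rightarrow> real) \<Rightarrow>
     (complex \<Rightarrow> real \<Rightarrow> complex) \<Rightarrow> (complex \<Rightarrow> real \<Rightarrow> complex) \<Rightarrow> complex \<Rightarrow> real \<Rightarrow> complex" where
  "evans_lopatinsky F Hs X H h q lam xi =
     (let Q = discharge F Hs H in
      det (vector
        [vector [jump X (\<lambda>x. lam * of_real (H x)),
                 bloch_jump X xi (lin_flux1 F Hs (h lam) (q lam))],
         vector [jump X (\<lambda>x. lam * of_real (Q x) - of_real (H x - (Q x)^2 / (H x)^2)),
                 bloch_jump X xi (lin_flux2 F Hs H (h lam) (q lam))]] :: complex^2^2))"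

text \<open>
  The analytic quotient of \<open>D\<close> by \<open>lam\<close>; it is determined by \<open>D\<close>, its value at \<open>lam = 0\<close> being
  forced by continuity.
\<close>

definition is_reduced_determinant ::
  "real \<Rightarrow> real \<Rightarrow> real \<Rightarrow> (complex \<Rightarrow> real \<Rightarrow> complex) \<Rightarrow> (complex \<Rightarrow> real \<Rightarrow> complex) \<Rightarrow> bool" where
  "is_reduced_determinant F Hs X D Dhat \<longleftrightarrow>
     (\<forall>xi\<in>{-pi/X..pi/X}.
        (\<lambda>lam. Dhat lam xi) holomorphic_on spectral_domain F Hs \<and>
        (\<forall>lam\<in>spectral_domain F Hs. D lam xi = lam * Dhat lam xi))"

text \<open>
  \<open>isolated_zero\<close> excludes functions vanishing identically near the point, for which \<open>zorder\<close>
  is unspecified.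
\<close>

definition double_root :: "(complex \<Rightarrow> complex) \<Rightarrow> complex \<Rightarrow> bool" where
  "double_root f z \<longleftrightarrow> f z = 0 \<and> isolated_zero f z \<and> zorder f z = 2"

text \<open>
  For \<open>xi\<close> near \<open>0\<close>, the roots of \<open>D(\<cdot>, xi)\<close> in a fixed disc about \<open>0\<close>, counted with
  multiplicity, are exactly \<open>lam1 xi\<close> and \<open>lam2 xi\<close>.
\<close>

definition two_roots_near_0 ::
  "(complex \<Rightarrow> real \<Rightarrow> complex) \<Rightarrow> (real \<Rightarrow> complex) \<Rightarrow> (real \<Rightarrow> complex) \<Rightarrow> bool" where
  "two_roots_near_0 D lam1 lam2 \<longleftrightarrow>
     (\<exists>r>0. \<forall>\<^sub>F xi in nhds 0. lam1 xi \<in> ball 0 r \<and> lam2 xi \<in> ball 0 r \<and>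
        (\<exists>g. g holomorphic_on ball 0 r \<and>
             (\<forall>lam\<in>ball 0 r. g lam \<noteq> 0 \<and>
                D lam xi = (lam - lam1 xi) * (lam - lam2 xi) * g lam)))"

text \<open>
  Modulation quantities. \<open>X\<close> and \<open>H\<close> give the period and the profile as functions of the wave
  parameters, and points of \<open>real^2\<close> are parameter pairs \<open>(Hs, Hm)\<close>.
\<close>

definition mean_height ::
  "(real \<Rightarrow> real \<Rightarrow> real) \<Rightarrow> (real \<Rightarrow> real \<Rightarrow> real \<Rightarrow> real) \<Rightarrow> real \<Rightarrow> real \<Rightarrow> real" where
  "mean_height X H Hs Hm = 1 / X Hs Hm * integral {0..X Hs Hm} (H Hs Hm)"

definition mean_discharge ::
  "real \<Rightarrow> (real \<Rightarrow> real \<Rightarrow> real) \<Rightarrow> (real \<Rightarrow> real \<Rightarrow> real \<Rightarrow> real) \<Rightarrow> real \<Rightarrow> real \<Rightarrow> real" where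
  "mean_discharge F X H Hs Hm =
     1 / X Hs Hm * integral {0..X Hs Hm} (discharge F Hs (H Hs Hm))"

definition wave_number :: "(real \<Rightarrow> real \<Rightarrow> real) \<Rightarrow> real \<Rightarrow> real \<Rightarrow> real" where
  "wave_number X Hs Hm = 1 / X Hs Hm"

definition frequency :: "real \<Rightarrow> (real \<Rightarrow> real \<Rightarrow> real) \<Rightarrow> real \<Rightarrow> real \<Rightarrow> real" where
  "frequency F X Hs Hm = - wave_number X Hs Hm * speed F Hs"

definition whitham_density ::
  "(real \<Rightarrow> real \<Rightarrow> real) \<Rightarrow> (real \<Rightarrow> real \<Rightarrow> real \<Rightarrow> real) \<Rightarrow> real^2 \<Rightarrow> real^2" where
  "whitham_density X H p =
     vector [mean_height X H (p$1) (p$2), wave_number X (p$1) (p$2)]"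

definition whitham_flux ::
  "real \<Rightarrow> (real \<Rightarrow> real \<Rightarrow> real) \<Rightarrow> (real \<Rightarrow> real \<Rightarrow> real \<Rightarrow> real) \<Rightarrow> real^2 \<Rightarrow> real^2" where
  "whitham_flux F X H p =
     vector [mean_discharge F X H (p$1) (p$2), - frequency F X (p$1) (p$2)]"

text \<open>
  Characteristics at \<open>p\<close> of the system of conservation laws with density \<open>G0\<close> and flux \<open>G1\<close>:
  the complex eigenvalues of the inverse of \<open>dG0\<close> times \<open>dG1\<close>. In dimension two the set of
  eigenvalues also determines their multiplicities.
\<close>

definition characteristics :: "(real^2 \<Rightarrow> real^2) \<Rightarrow> (real^2 \<Rightarrow> real^2) \<Rightarrow> real^2 \<Rightarrow> complex set" where
  "characteristics G0 G1 p =
     {mu. \<exists>v :: complex^2. v \<noteq> 0 \<and>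
        map_matrix complex_of_real (matrix_inv (jacobian G0 (at p)) ** jacobian G1 (at p)) *v v
          = mu *s v}"

end

theory Submission
  imports Defs
begin

text \<open>
  At \<open>\<lambda> = 0\<close> the normalized analytic solution is \<open>(H', Q')\<close>: away from the sonic point the equations
  leave only multiples of it, and continuity at the sonic point matches the two multiples. Its
  \<open>\<lambda>\<close>-derivative at \<open>0\<close> is, up to a multiple of \<open>H'\<close> that does not affect the determinant, the
  derivative of the profile in the wave parameter \<open>s = Hs\<close>, which is explicit because waves of equal
  Froude number are rescalings of one another. This gives closed formulas for both derivatives of
  the reduced determinant at \<open>(0, 0)\<close>.

  The same scaling makes period and mass functions of \<open>Hm / Hs\<close> up to powers of \<open>Hs\<close>. As speed and
  \<open>q0\<close> do not depend on \<open>Hm\<close>, the Whitham flux Jacobian is \<open>c A\<^sup>0\<close> plus a matrix with vanishing second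
  column, so the characteristics are \<open>c\<close> and \<open>c\<close> plus one matrix entry. That entry equals \<open>\<alpha>\<close>, and
  \<open>det A\<^sup>0\<close> is a nonzero multiple of the \<open>\<lambda>\<close>-derivative of the reduced determinant.
\<close>

text \<open>Two obstacles shape the argument. The eigenvalue equations degenerate at the sonic
  point, where the leading coefficient \<open>a(H)\<close> vanishes, so the standard uniqueness
  theorem stops there; solutions are instead compared with \<open>H'\<close> through a quotient.
  Moreover, regularity in \<lambda> is given as holomorphy at each point together with joint
  continuity, so \<lambda>-derivatives are taken in the integrated equations and the differential
  equation is recovered afterwards.

  On the modulation side the height serves as integration variable on a cell. Period and mass become
  integrals of fixed functions between \<open>m / s\<close> and \<open>P / s\<close>, so their
  derivatives involve only the end points and the jump condition that links them. The two sides meet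
  because the profile equation \<open>a(H) H' = R(H)\<close> expresses the end-point contributions
  by source values: the combinations \<open>R P - R m\<close> and \<open>P * R m - m * R P\<close>
  arise both in the determinant and in the derivatives of period and mass.\<close>

no_notation fps_nth (infixl \<open>$\<close> 75)

section \<open>Parametric holomorphic functions and simple zeros\<close>

text \<open>Cauchy's formula writes the derivative as an integral over a fixed circle whose
  integrand is jointly continuous, so continuity of parametric integrals applies.\<close>

lemma continuous_on_deriv_parametric:
  fixes f :: "complex \<Rightarrow> 'a::topological_space \<Rightarrow> complex"
  assumes cont: "continuous_on (cball z r \<times> K) (\<lambda>(l, x). f l x)"
    and hol: "\<And>x. x \<in> K \<Longrightarrow> (\<lambda>l. f l x) holomorphic_on ball z r"
  shows "continuous_on (ball z r \<times> K) (\<lambda>(l, x). deriv (\<lambda>l. f l x) l)"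
proof (cases "r > 0")
  case True
  \<comment> \<open>The integrand of Cauchy's formula pulled back along
    \<open>circlepath z r\<close>; the last factor is the velocity of the path.\<close>
  define g where "g = (\<lambda>p t. f (circlepath z r t) (snd p) / (circlepath z r t - fst p)^2
      * (2 * pi * \<i> * r * exp (2 * of_real pi * \<i> * t)))"
  have circ: "circlepath z r t \<in> sphere z r" if "t \<in> {0..1}" for t
  proof -
    have "circlepath z r t \<in> path_image (circlepath z r)"
      using that by (simp add: path_image_def)
    then show ?thesis using True by simp
  qed
  have "continuous_on ((ball z r \<times> K) \<times> cbox 0 1) (\<lambda>(p, t). g p t)"
  proof -
    have c1: "continuous_on ((ball z r \<times> K) \<times> cbox 0 1) (\<lambda>y. circlepath z r (snd y))"
      unfolding circlepath case_prod_unfold by (intro continuous_intros)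
    have "continuous_on ((ball z r \<times> K) \<times> cbox 0 1)
        (\<lambda>y. (\<lambda>(l, x). f l x) (circlepath z r (snd y), snd (fst y)))"
      by (rule continuous_on_compose2[OF cont]) (use circ in \<open>auto intro!: continuous_intros c1[simplified]\<close>)
    then have c2: "continuous_on ((ball z r \<times> K) \<times> cbox 0 1)
        (\<lambda>y. f (circlepath z r (snd y)) (snd (fst y)))"
      by simp
    have "circlepath z r t \<noteq> l" if "t \<in> {0..1}" "l \<in> ball z r" for t l
      using circ[OF that(1)] that(2) by auto
    then show ?thesis
      unfolding g_def case_prod_unfold by (intro continuous_intros c1 c2) auto
  qed
  then have "continuous_on (ball z r \<times> K) (\<lambda>p. integral (cbox 0 1) (g p))"
    by (rule integral_continuous_on_param)
  then have "continuous_on (ball z r \<times> K)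
      (\<lambda>p. 1 / (2 * of_real pi * \<i>) * integral (cbox 0 1) (g p))"
    by (intro continuous_intros)
  moreover have "(\<lambda>(l, x). deriv (\<lambda>l. f l x) l) p
      = 1 / (2 * of_real pi * \<i>) * integral (cbox 0 1) (g p)" if "p \<in> ball z r \<times> K" for p
  proof -
    obtain l x where p: "p = (l, x)" "l \<in> ball z r" "x \<in> K" using \<open>p \<in> _\<close> by auto
    have "continuous_on (cball z r) (\<lambda>l. (\<lambda>(l, x). f l x) (l, x))"
      by (rule continuous_on_compose2[OF cont]) (use p in \<open>auto intro!: continuous_intros\<close>)
    then have cf: "continuous_on (cball z r) (\<lambda>l. f l x)" by simp
    have "deriv (\<lambda>l. f l x) l
        = 1 / (2 * of_real pi * \<i>) * contour_integral (circlepath z r) (\<lambda>u. f u x / (u - l)^2)"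
      using Cauchy_derivative_integral_circlepath(2)[OF cf hol[OF p(3)] p(2)]
      by (rule DERIV_imp_deriv)
    also have "contour_integral (circlepath z r) (\<lambda>u. f u x / (u - l)^2) = integral (cbox 0 1) (g p)"
      by (simp add: contour_integral_integral vector_derivative_circlepath g_def p)
    finally show ?thesis by (simp add: p)
  qed
  ultimately show ?thesis
    by (subst continuous_on_cong[OF refl, where g="\<lambda>p. 1 / (2 * of_real pi * \<i>) * integral (cbox 0 1) (g p)"]) auto
next
  case False
  then have "ball z r \<times> K = {}" by auto
  then show ?thesis by (simp only: continuous_on_empty)
qed

lemma has_field_derivative_integral_parametric:
  fixes f :: "complex \<Rightarrow> real \<Rightarrow> complex"
  assumes r: "r > 0" and cont: "continuous_on (cball z r \<times> {a..b}) (\<lambda>(l, x). f l x)"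
    and hol: "\<And>x. x \<in> {a..b} \<Longrightarrow> (\<lambda>l. f l x) holomorphic_on ball z r"
  shows "((\<lambda>l. integral {a..b} (f l)) has_field_derivative
            integral {a..b} (\<lambda>x. deriv (\<lambda>l. f l x) z)) (at z)"
proof -
  have "((\<lambda>l. integral (cbox a b) (f l)) has_field_derivative
      integral (cbox a b) ((\<lambda>l x. deriv (\<lambda>l. f l x) l) z)) (at z within ball z r)"
  proof (rule leibniz_rule_field_derivative)
    show "((\<lambda>l. f l t) has_field_derivative deriv (\<lambda>l. f l t) l) (at l within ball z r)"
      if "l \<in> ball z r" "t \<in> cbox a b" for l t
      using holomorphic_derivI[OF hol open_ball] that by auto
    show "f l integrable_on cbox a b" if "l \<in> ball z r" for l
    proof (rule integrable_continuous)
      have "continuous_on (cbox a b) (\<lambda>x. (\<lambda>(l, x). f l x) (l, x))"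
        by (rule continuous_on_compose2[OF cont]) (use that in \<open>auto intro!: continuous_intros\<close>)
      then show "continuous_on (cbox a b) (f l)" by simp
    qed
    show "continuous_on (ball z r \<times> cbox a b) (\<lambda>(l, x). deriv (\<lambda>l. f l x) l)"
      using continuous_on_deriv_parametric[OF cont hol] by simp
  qed (use r in auto)
  then show ?thesis using r by (simp add: at_within_open[of z "ball z r"])
qed

section \<open>Simple zeros and their perturbation\<close>

lemma isCont_eq_limit:
  fixes f g :: "'a::{perfect_space,t2_space} \<Rightarrow> 'b::t2_space"
  assumes "isCont f z" "isCont g z" "\<forall>\<^sub>F w in at z. f w = g w"
  shows "f z = g z"
  using tendsto_unique[OF at_neq_bot _ Lim_transform_eventually[OF _ assms(3)]] assms(1,2)
  unfolding isCont_def by metis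

text \<open>A zero of order two means \<open>f w = g w * w^2\<close> with
  \<open>g 0 \<noteq> 0\<close>. Cancelling one factor leaves \<open>A w = g w * w\<close>, off 0 by
  division and at 0 by continuity, so the derivative of \<open>A\<close> at 0 is
  \<open>g 0\<close>.\<close>

lemma double_root_deriv_cofactor:
  assumes U: "open U" "0 \<in> U" and A: "A holomorphic_on U"
    and fA: "\<And>l. l \<in> U \<Longrightarrow> f l = l * A l" and "double_root f 0"
  shows "A 0 = 0" "deriv A 0 \<noteq> 0"
proof -
  have f: "f holomorphic_on U"
    using A by (intro holomorphic_transform[OF _ fA[symmetric]] holomorphic_intros)
  have f0: "f 0 = 0" "isolated_zero f 0" "zorder f 0 = 2" using \<open>double_root f 0\<close> by (auto simp: double_root_def)
  obtain R where R: "R > 0" "ball 0 R \<subseteq> U" using U openE by blast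
  have "eventually (\<lambda>z. f z \<noteq> 0) (at 0)" using f0(2) unfolding isolated_zero_def by blast
  moreover have "eventually (\<lambda>z. z \<in> ball 0 R) (at (0::complex))"
    using R(1) by (intro eventually_at_in_open') auto
  ultimately have "eventually (\<lambda>z. f z \<noteq> 0 \<and> z \<in> ball 0 R) (at 0)" by eventually_elim auto
  then have nz: "\<exists>w\<in>ball 0 R. f w \<noteq> 0"
    using eventually_happens'[OF at_neq_bot[of "0::complex"]] by blast
  define g where "g = zor_poly f 0"
  have "\<exists>r. r > 0 \<and> cball (0::complex) r \<subseteq> ball 0 R \<and> g holomorphic_on cball 0 r \<and>
     (\<forall>w\<in>cball 0 r. f w = g w * w^2 \<and> g w \<noteq> 0)"
    using zorder_exist_zero[OF holomorphic_on_subset[OF f R(2)] open_ball connected_ball, of 0, OF _ nz] R(1)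
    unfolding g_def by (simp add: f0)
  then obtain r where r: "r > 0" "cball (0::complex) r \<subseteq> ball 0 R" "g holomorphic_on cball 0 r"
     "\<forall>w\<in>cball 0 r. f w = g w * w^2 \<and> g w \<noteq> 0"
    by blast
  have gh: "g holomorphic_on ball 0 r" using r(3) ball_subset_cball holomorphic_on_subset by blast
  have Ah: "A holomorphic_on ball 0 r" using A R r(2) ball_subset_cball[of 0 r]
    by (meson holomorphic_on_subset subset_trans)
  have eqA: "A w = g w * w" if "w \<in> ball 0 r" for w
  proof -
    have eq': "A w = g w * w" if "w \<in> ball 0 r - {0}" for w
    proof -
      have "w \<in> ball 0 R" using that r(2) ball_subset_cball[of 0 r] by blast
      then have "w * A w = g w * w^2" using fA[of w] r(4)[rule_format, of w] that r(2) R(2) by auto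
      then show ?thesis using that by (simp add: power2_eq_square)
    qed
    show ?thesis
    proof (cases "w = 0")
      case True
      have "isCont A 0" using holomorphic_on_imp_continuous_on[OF A] U
        by (simp add: continuous_on_eq_continuous_at)
      moreover have "isCont (\<lambda>w. g w * w) 0" using holomorphic_on_imp_continuous_on[OF gh] r(1)
        by (auto simp: continuous_on_eq_continuous_at)
      moreover have "eventually (\<lambda>w. A w = g w * w) (at 0)"
        using eq' eventually_at_in_open[of "ball 0 r" "0::complex"] r(1)
        by (auto elim!: eventually_mono)
      ultimately have "A 0 = g 0 * 0" by (rule isCont_eq_limit)
      then show ?thesis using True by simp
    qed (use eq' that in auto)
  qed
  then show "A 0 = 0" using r(1) by auto
  have "deriv A 0 = deriv (\<lambda>w. g w * w) 0"
    using eqA r(1) by (intro deriv_cong_ev eventually_mono[OF eventually_nhds_in_open[of "ball 0 r"]]) auto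
  also have "\<dots> = g 0"
    using holomorphic_derivI[OF gh open_ball, of 0] r(1)
    by (intro DERIV_imp_deriv) (auto intro!: derivative_eq_intros)
  finally show "deriv A 0 \<noteq> 0" using r(1) r(4)[rule_format, of 0] by auto
qed

text \<open>The zero is the fixed point of the Newton-type contraction
  \<open>l \<mapsto> l - (A l + e * B l) / A' 0\<close>.\<close>

lemma perturbed_simple_zero:
  fixes A B :: "complex \<Rightarrow> complex"
  assumes U: "open U" "0 \<in> U" and A: "A holomorphic_on U" and B: "B holomorphic_on U"
    and A0: "A 0 = 0" and A1: "deriv A 0 \<noteq> 0"
  obtains r d C L where "r > 0" "cball 0 r \<subseteq> U" "d > 0" "C \<ge> 0"
    "\<And>e. norm e < d \<Longrightarrow> L e \<in> ball 0 r"
    "\<And>e. norm e < d \<Longrightarrow> \<exists>g. g holomorphic_on ball 0 r \<and>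
        (\<forall>l\<in>ball 0 r. g l \<noteq> 0 \<and> A l + e * B l = (l - L e) * g l)"
    "\<And>e. norm e < d \<Longrightarrow> norm (L e + e * B 0 / deriv A 0) \<le> C * (norm e)^2"
proof -
  define a where "a = deriv A 0"
  have a: "norm a > 0" using A1 by (simp add: a_def)
  obtain R where R: "R > 0" "cball 0 R \<subseteq> U" using U open_contains_cball by blast
  have hol: "deriv A holomorphic_on U" "deriv (deriv A) holomorphic_on U" "deriv B holomorphic_on U"
    using A B U by (auto intro!: holomorphic_deriv)
  have bdd: "\<exists>M>0. \<forall>l\<in>cball 0 R. norm (f l) \<le> M" if "f holomorphic_on U" for f :: "complex \<Rightarrow> complex"
  proof -
    have "compact (f ` cball 0 R)"
      using continuous_on_subset[OF holomorphic_on_imp_continuous_on[OF that] R(2)]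
      by (intro compact_continuous_image) auto
    then have "bounded (f ` cball 0 R)" by (rule compact_imp_bounded)
    then show ?thesis by (auto simp: bounded_pos)
  qed
  obtain M2 where M2: "M2 > 0" "\<And>l. l \<in> cball 0 R \<Longrightarrow> norm (deriv (deriv A) l) \<le> M2" using bdd[OF hol(2)] by blast
  obtain N0 where N0: "N0 > 0" "\<And>l. l \<in> cball 0 R \<Longrightarrow> norm (B l) \<le> N0" using bdd[OF B] by blast
  obtain N1 where N1: "N1 > 0" "\<And>l. l \<in> cball 0 R \<Longrightarrow> norm (deriv B l) \<le> N1" using bdd[OF hol(3)] by blast
  have D: "(f has_field_derivative deriv f l) (at l within S)" if "f holomorphic_on U" "l \<in> cball 0 R"
    for f :: "complex \<Rightarrow> complex" and l S
    using holomorphic_derivI[OF that(1) U(1)] that(2) R(2) by blast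
  have lipA: "norm (deriv A l - a) \<le> M2 * norm l" if "l \<in> cball 0 R" for l
    using field_differentiable_bound[OF convex_cball D[OF hol(1)] M2(2) that, of 0] R(1) by (simp add: a_def)
  \<comment> \<open>The radius makes \<open>A'\<close> differ from \<open>a\<close> by at most a
    quarter of \<open>norm a\<close>; the bound \<open>d\<close> on the perturbation adds another
    quarter. This gives the contraction constant 1/2. The last condition on \<open>d\<close> yields
    \<open>norm (T e 0) \<le> r / 4\<close>, so the disc is mapped strictly into itself.\<close>
  define r where "r = min R (norm a / (4 * M2))"
  have r: "r > 0" "r \<le> R" "M2 * r \<le> norm a / 4"
    using R(1) a M2(1) by (auto simp: r_def min_def field_simps)
  have rR: "cball 0 r \<subseteq> cball (0::complex) R" using r by auto
  define d where "d = min (norm a / (4 * N1)) (norm a * r / (4 * N0))"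
  have d: "d > 0" "d * N1 \<le> norm a / 4" "d * N0 \<le> norm a * r / 4"
    using r a N1(1) N0(1) by (auto simp: d_def min_def field_simps)
  define T where "T = (\<lambda>e l. l - (A l + e * B l) / a)"
  have DT: "(T e has_field_derivative 1 - (deriv A l + e * deriv B l) / a) (at l within S)"
    if "l \<in> cball 0 r" for e l S
    unfolding T_def using D[OF A, of l S] D[OF B, of l S] that rR a
    by (auto intro!: derivative_eq_intros)
  have DTb: "norm (1 - (deriv A l + e * deriv B l) / a) \<le> 1/2" if "l \<in> cball 0 r" "norm e < d" for e l
  proof -
    have lR: "l \<in> cball 0 R" using that(1) rR by auto
    have "M2 * norm l \<le> M2 * r" using M2(1) that(1) by (intro mult_left_mono) auto
    then have "norm (deriv A l - a) \<le> norm a / 4" using lipA[OF lR] r(3) by linarith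
    moreover have "norm (e * deriv B l) \<le> norm a / 4"
      using mult_mono[of "norm e" d "norm (deriv B l)" N1] N1 lR that(2) d by (auto simp: norm_mult)
    ultimately have "norm ((deriv A l - a) + e * deriv B l) \<le> norm a / 2"
      using norm_triangle_ineq[of "deriv A l - a" "e * deriv B l"] by linarith
    moreover have "1 - (deriv A l + e * deriv B l) / a = - (((deriv A l - a) + e * deriv B l) / a)"
      using a by (auto simp: field_simps)
    ultimately show ?thesis using a by (simp only: norm_minus_cancel norm_divide) (simp add: field_simps)
  qed
  have lipT: "norm (T e l - T e l') \<le> 1/2 * norm (l - l')"
    if "l \<in> cball 0 r" "l' \<in> cball 0 r" "norm e < d" for e l l'
    using field_differentiable_bound[OF convex_cball DT DTb that(1,2)] that(3) by blast
  have T0: "T e 0 = - (e * B 0 / a)" for e by (simp add: T_def A0)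
  have T0b: "norm (T e 0) \<le> norm e * N0 / norm a" for e
    unfolding T0 using N0(2)[of 0] R(1) by (simp add: norm_mult norm_divide divide_right_mono mult_left_mono)
  have T0c: "norm (T e 0) \<le> r / 4" if "norm e < d" for e
  proof -
    have "norm e * N0 \<le> norm a * r / 4"
      using mult_right_mono[of "norm e" d N0] that N0(1) d(3) by linarith
    then have "norm e * N0 / norm a \<le> r / 4" using a by (simp add: field_simps)
    then show ?thesis using T0b[of e] by linarith
  qed
  have Tin: "norm (T e l) < r" if "l \<in> cball 0 r" "norm e < d" for e l
  proof -
    have "norm (T e l) \<le> norm (T e 0) + norm (T e l - T e 0)"
      using norm_triangle_ineq[of "T e 0" "T e l - T e 0"] by simp
    then show ?thesis using lipT[OF that(1) _ that(2), of 0] T0c[OF that(2)] r(1) that(1) by simp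
  qed
  have "\<exists>!l. l \<in> cball 0 r \<and> T e l = l" if "norm e < d" for e
  proof -
    have "\<exists>!l\<in>cball 0 r. T e l = l"
      by (rule Banach_fix[where c="1/2"])
        (use Tin lipT that r(1) in \<open>auto simp: dist_norm less_imp_le complete_eq_closed\<close>)
    then show ?thesis .
  qed
  then obtain L where L: "\<And>e. norm e < d \<Longrightarrow> L e \<in> cball 0 r \<and> T e (L e) = L e"
    and Lu: "\<And>e l. norm e < d \<Longrightarrow> l \<in> cball 0 r \<Longrightarrow> T e l = l \<Longrightarrow> l = L e" by metis
  have Lball: "L e \<in> ball 0 r" if "norm e < d" for e
    using Tin[of "L e" e] L[OF that] that by auto
  show ?thesis
  proof (rule that[of r d "(M2 * (2 * N0 / norm a)^2 + N1 * (2 * N0 / norm a)) / norm a" L])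
    fix e :: complex assume e: "norm e < d"
    show "L e \<in> ball 0 r" by (rule Lball[OF e])
    define f where "f = (\<lambda>l. A l + e * B l)"
    have fh: "f holomorphic_on U" unfolding f_def using A B by (intro holomorphic_intros)
    have f_T: "f l = a * (l - T e l)" for l using a by (simp add: f_def T_def)
    have fL: "f (L e) = 0" using L[OF e] by (simp add: f_T)
    \<comment> \<open>The difference quotient with its removable singularity filled in. Off
      \<open>L e\<close> it is nonzero because the fixed point is unique; at \<open>L e\<close> a
      vanishing derivative of \<open>f\<close> would make the derivative of \<open>T e\<close> equal
      to 1, against the bound 1/2.\<close>
    define g where "g = (\<lambda>l. if l = L e then deriv f (L e) else (f l - f (L e)) / (l - L e))"
    have "g holomorphic_on ball 0 r"
      unfolding g_def using subset_trans[OF ball_subset_cball subset_trans[OF rR R(2)]]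
      by (intro pole_lemma_open holomorphic_on_subset[OF fh]) auto
    moreover have "g l \<noteq> 0 \<and> A l + e * B l = (l - L e) * g l" if l: "l \<in> ball 0 r" for l
    proof (cases "l = L e")
      case True
      have Le: "L e \<in> cball 0 r" using L[OF e] by simp
      then have LR: "L e \<in> cball 0 R" using rR by blast
      have "(f has_field_derivative deriv A (L e) + e * deriv B (L e)) (at (L e))"
        unfolding f_def by (auto intro!: derivative_eq_intros D[OF A LR] D[OF B LR])
      then have "deriv f (L e) = deriv A (L e) + e * deriv B (L e)" by (rule DERIV_imp_deriv)
      then have "deriv f (L e) \<noteq> 0" using DTb[OF Le e] by auto
      then show ?thesis using True fL by (simp add: g_def f_def)
    next
      case False
      then have "f l \<noteq> 0" using Lu[OF e, of l] l a by (auto simp: f_T)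
      then show ?thesis using False fL by (simp add: g_def) (simp add: f_def)
    qed
    ultimately show "\<exists>g. g holomorphic_on ball 0 r \<and>
        (\<forall>l\<in>ball 0 r. g l \<noteq> 0 \<and> A l + e * B l = (l - L e) * g l)" by blast
    have Le: "L e \<in> cball 0 r" "T e (L e) = L e" using L[OF e] by auto
    have LR: "L e \<in> cball 0 R" using Le(1) rR by blast
    have "norm (L e) \<le> norm (T e 0) + norm (T e (L e) - T e 0)"
      using norm_triangle_ineq[of "T e 0" "T e (L e) - T e 0"] Le(2) by simp
    then have "norm (L e) \<le> 2 * (norm e * N0 / norm a)"
      using lipT[OF Le(1) _ e, of 0] r(1) T0b[of e] by simp
    then have Lb: "norm (L e) \<le> 2 * N0 / norm a * norm e" by (simp add: mult_ac)
    \<comment> \<open>Working on the ball of radius \<open>norm (L e)\<close> bounds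
      \<open>A' - a\<close> by a multiple of \<open>norm (L e)\<close>, which makes the Taylor
      remainder of \<open>A\<close> quadratic.\<close>
    have sub: "cball 0 (norm (L e)) \<subseteq> cball (0::complex) R" using LR by auto
    have "norm ((A (L e) - a * L e) - (A 0 - a * 0)) \<le> M2 * norm (L e) * norm (L e - 0)"
    proof (rule field_differentiable_bound[OF convex_cball[of 0 "norm (L e)"]])
      fix l :: complex assume l: "l \<in> cball 0 (norm (L e))"
      then show "((\<lambda>l. A l - a * l) has_field_derivative deriv A l - a) (at l within cball 0 (norm (L e)))"
        using D[OF A] sub by (auto intro!: derivative_eq_intros)
      have "M2 * norm l \<le> M2 * norm (L e)" using l M2(1) by (intro mult_left_mono) auto
      then show "norm (deriv A l - a) \<le> M2 * norm (L e)"
        using order_trans[OF lipA] subsetD[OF sub l] by blast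
    qed auto
    then have b1: "norm (A (L e) - a * L e) \<le> M2 * (norm (L e))^2" by (simp add: A0 power2_eq_square)
    have "norm (B (L e) - B 0) \<le> N1 * norm (L e - 0)"
      by (rule field_differentiable_bound[OF convex_cball D[OF B] N1(2) LR]) (use R(1) in auto)
    then have b2: "norm (e * (B (L e) - B 0)) \<le> norm e * (N1 * norm (L e))"
      by (simp add: norm_mult mult_left_mono)
    have "f (L e) = 0" by (rule fL)
    then have "L e + e * B 0 / a = - ((A (L e) - a * L e) + e * (B (L e) - B 0)) / a"
      using a by (simp add: f_def field_simps)
    then have "norm (L e + e * B 0 / a) = norm ((A (L e) - a * L e) + e * (B (L e) - B 0)) / norm a"
      by (simp only: norm_divide norm_minus_cancel)
    also have "\<dots> \<le> (M2 * (norm (L e))^2 + norm e * (N1 * norm (L e))) / norm a"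
      using b1 b2 norm_triangle_ineq[of "A (L e) - a * L e" "e * (B (L e) - B 0)"]
      by (intro divide_right_mono) auto
    also have "\<dots> \<le> (M2 * (2 * N0 / norm a * norm e)^2 + norm e * (N1 * (2 * N0 / norm a * norm e))) / norm a"
      using Lb M2(1) N1(1) by (intro divide_right_mono add_mono mult_left_mono power_mono) auto
    also have "\<dots> = (M2 * (2 * N0 / norm a)^2 + N1 * (2 * N0 / norm a)) / norm a * (norm e)^2"
      by (simp add: power2_eq_square algebra_simps add_divide_distrib)
    finally show "norm (L e + e * B 0 / deriv A 0)
        \<le> (M2 * (2 * N0 / norm a)^2 + N1 * (2 * N0 / norm a)) / norm a * (norm e)^2"
      by (simp add: a_def)
  qed (use r d R rR M2(1) N0(1) N1(1) in auto)
qed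

lemma exp_imaginary_bounds:
  fixes x :: real
  shows "cmod (1 - exp (\<i> * of_real x) + \<i> * of_real x) \<le> x^2" "cmod (1 - exp (\<i> * of_real x)) \<le> \<bar>x\<bar> + x^2"
proof -
  have "cmod (exp (\<i> * of_real x) - (\<Sum>k\<le>1. (\<i> * of_real x)^k / fact k)) \<le> exp \<bar>Re (\<i> * of_real x)\<bar> * cmod (\<i> * of_real x)^(Suc 1) / fact 1"
    by (rule Taylor_exp)
  then have "cmod (exp (\<i> * of_real x) - (1 + \<i> * of_real x)) \<le> x^2"
    by (simp add: norm_mult power2_eq_square)
  moreover have "1 - exp (\<i> * of_real x) + \<i> * of_real x = - (exp (\<i> * of_real x) - (1 + \<i> * of_real x))" by simp
  ultimately show b: "cmod (1 - exp (\<i> * of_real x) + \<i> * of_real x) \<le> x^2" by (simp only: norm_minus_cancel)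
  show "cmod (1 - exp (\<i> * of_real x)) \<le> \<bar>x\<bar> + x^2"
    using norm_triangle_ineq4[of "1 - exp (\<i> * of_real x) + \<i> * of_real x" "\<i> * of_real x"] b
    by (simp add: norm_mult)
qed

text \<open>The factor \<open>l\<close> is the root that stays at 0. The other one is the perturbed
  zero of \<open>A\<close> for the parameter \<open>e = 1 - exp (i xi X)\<close>. As
  \<open>e = - i xi X + O(xi^2)\<close>, its leading term \<open>- e * B 0 / A' 0\<close> is
  \<open>- i xi \<alpha>\<close>.\<close>

lemma roots_of_affine_perturbation:
  fixes A B :: "complex \<Rightarrow> complex" and X :: real
  assumes U: "open U" "0 \<in> U" and A: "A holomorphic_on U" and B: "B holomorphic_on U"
    and A0: "A 0 = 0" and A1: "deriv A 0 \<noteq> 0"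
    and D: "\<And>l xi. l \<in> U \<Longrightarrow> D l xi = l * (A l + (1 - exp (\<i> * of_real (xi * X))) * B l)"
  defines "\<alpha> \<equiv> - of_real X * B 0 / deriv A 0"
  shows "\<exists>lam1 lam2. two_roots_near_0 D lam1 lam2 \<and>
    (\<lambda>xi. lam1 xi - (- \<i> * of_real xi * \<alpha>)) \<in> O[at 0](\<lambda>xi. of_real (xi^2)) \<and> (\<forall>xi. lam2 xi = 0)"
proof -
  define e where "e xi = 1 - exp (\<i> * complex_of_real (xi * X))" for xi
  obtain r d C L where r: "r > 0" "cball 0 r \<subseteq> U" and d: "d > 0" and C: "C \<ge> 0"
    and Lr: "\<And>e. norm e < d \<Longrightarrow> L e \<in> ball 0 r"
    and g: "\<And>e. norm e < d \<Longrightarrow> \<exists>g. g holomorphic_on ball 0 r \<and>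
        (\<forall>l\<in>ball 0 r. g l \<noteq> 0 \<and> A l + e * B l = (l - L e) * g l)"
    and est: "\<And>e. norm e < d \<Longrightarrow> norm (L e + e * B 0 / deriv A 0) \<le> C * (norm e)^2"
    using perturbed_simple_zero[OF U A B A0 A1] by metis
  have "continuous (at 0) e" unfolding e_def by (intro continuous_intros)
  then have "(e \<longlongrightarrow> e 0) (nhds 0)" by (simp add: continuous_at tendsto_nhds_iff)
  then have "\<forall>\<^sub>F xi in nhds 0. dist (e xi) (e 0) < d" using d by (rule tendstoD)
  then have ev: "\<forall>\<^sub>F xi in nhds 0. norm (e xi) < d" by (simp add: e_def)
  have "two_roots_near_0 D (\<lambda>xi. L (e xi)) (\<lambda>_. 0)"
    unfolding two_roots_near_0_def
  proof (intro exI[of _ r] conjI, fact r(1), use ev in eventually_elim)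
    case (elim xi)
    obtain g where "g holomorphic_on ball 0 r" "\<And>l. l \<in> ball 0 r \<Longrightarrow> g l \<noteq> 0"
      and gl: "\<And>l. l \<in> ball 0 r \<Longrightarrow> A l + e xi * B l = (l - L (e xi)) * g l"
      using g[OF elim] by blast
    moreover have "D l xi = (l - L (e xi)) * (l - 0) * g l" if "l \<in> ball 0 r" for l
    proof -
      have "l \<in> U" using that r(2) ball_subset_cball[of 0 r] by blast
      then have "D l xi = l * (A l + e xi * B l)" by (simp add: D e_def)
      then show ?thesis using gl[OF that] by simp
    qed
    ultimately show ?case using Lr[OF elim] r(1) by auto
  qed
  moreover have "(\<lambda>xi. L (e xi) - (- \<i> * of_real xi * \<alpha>)) \<in> O[at 0](\<lambda>xi. of_real (xi^2))"
  \<comment> \<open>The first summand comes from the quadratic error in \<open>e\<close> and a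
    linear bound on \<open>e\<close> for \<open>\<bar>xi\<bar> \<le> 1\<close>, the second from
    replacing \<open>e\<close> by its linear part.\<close>
  proof (rule bigoI[where c="C * (\<bar>X\<bar> + X^2)^2 + X^2 * norm (B 0 / deriv A 0)"])
    have "\<forall>\<^sub>F xi in at 0. norm (e xi) < d" using ev by (simp add: eventually_nhds_conv_at)
    moreover have "\<forall>\<^sub>F xi in at (0::real). xi \<in> {-1<..<1}"
      by (rule eventually_at_in_open') auto
    ultimately show "\<forall>\<^sub>F xi in at 0. norm (L (e xi) - (- \<i> * of_real xi * \<alpha>))
        \<le> (C * (\<bar>X\<bar> + X^2)^2 + X^2 * norm (B 0 / deriv A 0)) * norm (complex_of_real (xi^2))"
    proof eventually_elim
      case (elim xi)
      have xi: "\<bar>xi\<bar> \<le> 1" using elim(2) by auto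
      have "xi^2 = \<bar>xi\<bar> * \<bar>xi\<bar>" by (simp add: power2_eq_square)
      also have "\<dots> \<le> \<bar>xi\<bar> * 1" by (rule mult_left_mono) (use xi in auto)
      finally have xi2: "xi^2 \<le> \<bar>xi\<bar>" by simp
      have "norm (e xi) \<le> \<bar>xi * X\<bar> + (xi * X)^2" unfolding e_def by (rule exp_imaginary_bounds)
      also have "\<dots> \<le> \<bar>xi\<bar> * (\<bar>X\<bar> + X^2)"
        using mult_right_mono[OF xi2, of "X^2"] by (simp add: abs_mult power_mult_distrib distrib_left)
      finally have "norm (e xi) \<le> \<bar>xi\<bar> * (\<bar>X\<bar> + X^2)" .
      then have "(norm (e xi))^2 \<le> (\<bar>xi\<bar> * (\<bar>X\<bar> + X^2))^2" by (rule power_mono) simp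
      then have "C * (norm (e xi))^2 \<le> C * ((\<bar>X\<bar> + X^2)^2 * xi^2)"
        using C by (intro mult_left_mono) (auto simp: power_mult_distrib mult.commute)
      then have 1: "norm (L (e xi) + e xi * B 0 / deriv A 0) \<le> C * (\<bar>X\<bar> + X^2)^2 * xi^2"
        using est[OF elim(1)] by simp
      have "norm ((e xi + \<i> * of_real (xi * X)) * (B 0 / deriv A 0)) \<le> (xi * X)^2 * norm (B 0 / deriv A 0)"
        unfolding norm_mult e_def by (intro mult_right_mono exp_imaginary_bounds) simp
      then have 2: "norm ((e xi + \<i> * of_real (xi * X)) * (B 0 / deriv A 0)) \<le> X^2 * norm (B 0 / deriv A 0) * xi^2"
        by (simp add: power_mult_distrib mult_ac)
      have "L (e xi) - (- \<i> * of_real xi * \<alpha>)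
          = (L (e xi) + e xi * B 0 / deriv A 0) - (e xi + \<i> * of_real (xi * X)) * (B 0 / deriv A 0)"
        unfolding \<alpha>_def using A1 by (simp add: field_simps)
      then have "norm (L (e xi) - (- \<i> * of_real xi * \<alpha>)) \<le> norm (L (e xi) + e xi * B 0 / deriv A 0)
          + norm ((e xi + \<i> * of_real (xi * X)) * (B 0 / deriv A 0))"
        by (simp only: norm_triangle_ineq4)
      also have "\<dots> \<le> (C * (\<bar>X\<bar> + X^2)^2 + X^2 * norm (B 0 / deriv A 0)) * xi^2"
        using 1 2 by (simp only: distrib_right)
      finally show ?case by (simp add: norm_power)
    qed
  qed
  ultimately show ?thesis by blast
qed

section \<open>The wave profile\<close>

text \<open>The right-hand side of the profile equation after inserting the speed and
  \<open>q0\<close>, which removes all square roots of \<open>s\<close>.\<close>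

definition wave_slope :: "real \<Rightarrow> real \<Rightarrow> real \<Rightarrow> real" where
  "wave_slope F s y = (F^2 * y^2 - s * (2 * F + 1) * y + s^2) / (y^2 + s * y + s^2)"

text \<open>The derivative of \<open>q0^2 / y + y^2 / (2 F^2)\<close>, the function equated at the
  two ends of the cell by the jump condition.\<close>

definition flux_deriv :: "real \<Rightarrow> real \<Rightarrow> real \<Rightarrow> real" where
  "flux_deriv F s y = y / F^2 - (q0 F s)^2 / y^2"

text \<open>The source term \<open>h - q^2 / h^2\<close> with the discharge expressed by the height
  along the wave.\<close>

definition source :: "real \<Rightarrow> real \<Rightarrow> real \<Rightarrow> real" where
  "source F s y = y - (speed F s * y - q0 F s)^2 / y^2"

lemma q0_eq: "s > 0 \<Longrightarrow> q0 F s = sqrt s * s / F"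
  by (simp add: q0_def powr_add[of s 1 "1/2", simplified] powr_half_sqrt mult.commute)

lemma q0_sq: "s > 0 \<Longrightarrow> (q0 F s)^2 = s^3 / F^2"
  by (simp add: q0_eq power_mult_distrib power_divide power3_eq_cube power2_eq_square)

lemma speed_q0:
  assumes "F > 0" "s > 0"
  shows "F^2 * (speed F s)^2 = s * (F + 1)^2" "F^2 * (speed F s * q0 F s) = s^2 * (F + 1)"
proof -
  have r: "sqrt s * sqrt s = s" using assms by simp
  show "F^2 * (speed F s)^2 = s * (F + 1)^2"
  proof -
    have "F * (1 + 1 / F) = F + 1" using assms by (simp add: field_simps)
    then have "F^2 * (1 + 1 / F)^2 = (F + 1)^2" by (metis power_mult_distrib)
    then show ?thesis using assms by (simp add: speed_def power_mult_distrib)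
  qed
  show "F^2 * (speed F s * q0 F s) = s^2 * (F + 1)"
    using assms r by (simp add: speed_def q0_eq field_simps power2_eq_square)
qed

lemma wave_slope_eq:
  assumes "F > 0" "s > 0" "y > 0"
  shows "F^2 * (y^2 + (s - (speed F s)^2) * y + (q0 F s)^2 / s) / (y^2 + s * y + s^2) = wave_slope F s y"
proof -
  have "F^2 * (y^2 + (s - (speed F s)^2) * y + (q0 F s)^2 / s)
      = F^2 * y^2 + (F^2 * s - F^2 * (speed F s)^2) * y + F^2 * (s^3 / F^2) / s"
    unfolding q0_sq[OF assms(2)] by (simp add: algebra_simps)
  also have "\<dots> = F^2 * y^2 + (F^2 * s - s * (F + 1)^2) * y + s^2"
    unfolding speed_q0(1)[OF assms(1,2)] using assms by (simp add: power3_eq_cube power2_eq_square)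
  also have "\<dots> = F^2 * y^2 - s * (2 * F + 1) * y + s^2" by (simp add: power2_eq_square algebra_simps)
  finally show ?thesis by (simp add: wave_slope_def)
qed

text \<open>The lower bound on \<open>y\<close> is the larger root of the numerator: times
  \<open>4 * F^2\<close>, the numerator is a square minus \<open>(1 + 4 * F) * s^2\<close>.\<close>

lemma wave_slope_pos:
  assumes "F > 0" "s > 0" "(1 + 2 * F + sqrt (1 + 4 * F)) / (2 * F^2) * s < y"
  shows "wave_slope F s y > 0" "y > 0"
proof -
  have "0 \<le> (1 + 2 * F + sqrt (1 + 4 * F)) / (2 * F^2) * s" using assms by simp
  then show y: "y > 0" using assms(3) by linarith
  have "sqrt (1 + 4 * F) * s < 2 * F^2 * y - (1 + 2 * F) * s"
    using assms by (simp add: field_simps)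
  then have "(sqrt (1 + 4 * F) * s)^2 < (2 * F^2 * y - (1 + 2 * F) * s)^2"
    using assms by (intro power_strict_mono) auto
  then have "(1 + 4 * F) * s^2 < (2 * F^2 * y - (1 + 2 * F) * s)^2"
    using assms by (simp add: power_mult_distrib)
  also have "\<dots> = 4 * F^2 * (F^2 * y^2 - s * (2 * F + 1) * y + s^2) + (1 + 4 * F) * s^2"
    by (simp add: power2_eq_square algebra_simps)
  finally have "0 < F^2 * (F^2 * y^2 - s * (2 * F + 1) * y + s^2)" by simp
  then have "0 < F^2 * y^2 - s * (2 * F + 1) * y + s^2" using assms(1) by (simp add: zero_less_mult_iff)
  then show "wave_slope F s y > 0"
    unfolding wave_slope_def using y assms(2) by (intro divide_pos_pos) (auto intro!: add_pos_pos)
qed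

text \<open>Flux derivative and source share the factor \<open>y - s\<close>. Cancelling it turns
  the degenerate equation \<open>a(H) H' = R(H)\<close> into the regular one with right-hand side
  \<open>wave_slope\<close>.\<close>

lemma flux_deriv_mult_slope:
  assumes "F > 0" "s > 0" "y > 0"
  shows "flux_deriv F s y * wave_slope F s y = source F s y"
proof -
  have d: "y^2 + s * y + s^2 \<noteq> 0" using assms by (auto simp: add_pos_pos less_imp_neq[THEN not_sym])
  have "F^2 * y^2 * flux_deriv F s y = y^3 - s^3"
    unfolding flux_deriv_def q0_sq[OF assms(2)]
    using assms by (simp add: field_simps power3_eq_cube power2_eq_square)
  also have "\<dots> = (y - s) * (y^2 + s * y + s^2)" by (simp add: power3_eq_cube power2_eq_square algebra_simps)
  finally have 1: "F^2 * y^2 * flux_deriv F s y = (y - s) * (y^2 + s * y + s^2)" .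
  have "F^2 * y^2 * source F s y = F^2 * y^3 - F^2 * (speed F s * y - q0 F s)^2"
    using assms by (simp add: source_def field_simps power3_eq_cube power2_eq_square)
  also have "\<dots> = F^2 * y^3 - (F^2 * (speed F s)^2) * y^2 + 2 * (F^2 * (speed F s * q0 F s)) * y - F^2 * (q0 F s)^2"
    by (simp add: power2_eq_square algebra_simps)
  also have "\<dots> = F^2 * y^3 - s * (F + 1)^2 * y^2 + 2 * (s^2 * (F + 1)) * y - s^3"
    using assms by (simp add: speed_q0 q0_sq)
  also have "\<dots> = (y - s) * (F^2 * y^2 - s * (2 * F + 1) * y + s^2)"
    by (simp add: power3_eq_cube power2_eq_square algebra_simps)
  also have "\<dots> = (y - s) * (y^2 + s * y + s^2) * wave_slope F s y"
    using d by (simp add: wave_slope_def)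
  finally have "F^2 * y^2 * source F s y = F^2 * y^2 * (flux_deriv F s y * wave_slope F s y)"
    using 1 by simp
  then show ?thesis using assms by simp
qed

lemma flux_deriv_eq_0_iff:
  assumes "F > 0" "s > 0" "y > 0"
  shows "flux_deriv F s y = 0 \<longleftrightarrow> y = s"
proof -
  have "flux_deriv F s y = (y^3 - s^3) / (F^2 * y^2)"
    unfolding flux_deriv_def q0_sq[OF assms(2)]
    using assms by (simp add: field_simps power3_eq_cube power2_eq_square)
  moreover have "y^3 = s^3 \<longleftrightarrow> y = s" using assms by (simp add: power_eq_iff_eq_base)
  ultimately show ?thesis using assms by simp
qed

section \<open>One cell of a roll wave\<close>

locale roll_wave_profile =
  fixes F s m P X :: real and H :: "real \<Rightarrow> real"
  assumes F: "F > 2" and roll: "roll_wave F s m P X H"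
begin

abbreviation (input) "c \<equiv> speed F s"
abbreviation (input) "k \<equiv> q0 F s"
abbreviation (input) "a \<equiv> flux_deriv F s"
abbreviation (input) "R \<equiv> source F s"
abbreviation (input) "Q \<equiv> discharge F s H"

definition "H' x = wave_slope F s (H x)"
text \<open>With the derivatives of the speed \<open>c\<close> and of \<open>k\<close> taken in \<open>s\<close> at fixed \<open>F\<close>, these are
  \<open>1 / (s c')\<close> and \<open>k' / c'\<close>.\<close>

definition "\<beta> = 2 * F / (sqrt s * (F + 1))"
definition "\<gamma> = 3 * s / (F + 1)"
text \<open>Up to sign, the part of the first column of the determinant that does not vanish with
  \<lambda>.\<close>

definition "\<delta> = R P - R m"

lemma
  shows s: "s > 0" and ms: "m < s" and sP: "s < P" and X: "X > 0" and H0: "H 0 = m" and HX: "H X = P"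
    and RH: "k^2 / P + P^2 / (2*F^2) = k^2 / m + m^2 / (2*F^2)"
    and mono: "strict_mono_on {0..X} H"
    and m_bound: "(1 + 2 * F + sqrt (1 + 4 * F)) / (2 * F^2) * s < m"
  using roll by (auto simp: roll_wave_def wave_params_def)

lemma m: "m > 0"
  using wave_slope_pos(2)[OF _ s m_bound] F by simp

lemma H_range: "x \<in> {0..X} \<Longrightarrow> m \<le> H x \<and> H x \<le> P"
  using roll by (auto simp: roll_wave_def image_subset_iff)

lemma H_pos: "x \<in> {0..X} \<Longrightarrow> H x > 0"
  using H_range m by fastforce

lemma H'_pos: "x \<in> {0..X} \<Longrightarrow> H' x > 0"
  unfolding H'_def using wave_slope_pos(1)[OF _ s] m_bound H_range F by force

lemma wave_slope_P: "wave_slope F s P > 0" and wave_slope_m: "wave_slope F s m > 0"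
  using wave_slope_pos(1)[OF _ s] m_bound F ms sP by force+

lemma H_deriv_within: "x \<in> {0..X} \<Longrightarrow> (H has_real_derivative H' x) (at x within {0..X})"
  using roll wave_slope_eq[of F s "H x"] F s H_pos[of x] unfolding roll_wave_def H'_def by force

lemma H_deriv: "x \<in> {0<..<X} \<Longrightarrow> (H has_real_derivative H' x) (at x)"
  using H_deriv_within[of x] at_within_interior[of x "{0..X}"] by simp

lemma continuous_H: "continuous_on {0..X} H"
  by (rule DERIV_continuous_on[OF H_deriv_within])

lemma continuous_H': "continuous_on {0..X} H'"
proof -
  have "(H x)^2 + s * H x + s^2 \<noteq> 0" if "x \<in> {0..X}" for x
    using H_pos[OF that] s by (auto simp: add_pos_pos less_imp_neq[THEN not_sym])
  then show ?thesis
    unfolding H'_def wave_slope_def by (intro continuous_intros continuous_H) auto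
qed

lemma a_mult_H': "x \<in> {0..X} \<Longrightarrow> a (H x) * H' x = R (H x)"
  unfolding H'_def using flux_deriv_mult_slope[OF _ s H_pos] F by simp

lemma \<beta>_pos: "\<beta> > 0"
  using F s by (simp add: \<beta>_def)

text \<open>The speed has degree 1/2 in \<open>s\<close>, hence \<open>s c' = c / 2\<close>.
  Likewise \<open>\<beta>_k\<close> reflects that \<open>k\<close> has degree 3/2.\<close>

lemma \<beta>_c: "\<beta> * c = 2"
proof -
  have "1 + 1 / F = (F + 1) / F" "F + 1 \<noteq> 0" using F by (simp_all add: field_simps)
  then show ?thesis using F s by (simp add: \<beta>_def speed_def)
qed

lemma \<beta>_k: "3 * (\<beta> * k) = 2 * \<gamma>"
  using F s by (simp add: \<beta>_def \<gamma>_def q0_eq)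

lemma Q_0: "Q 0 = c * m - k" and Q_X: "Q X = c * P - k"
  by (simp_all add: discharge_def H0 HX)

lemma integrable_H: "H integrable_on {0..X}"
  by (intro integrable_continuous_real continuous_H)

definition "mass = integral {0..X} H"

text \<open>At \<open>\<lambda> = 0\<close> the eigenvalue equations for the analytic solution reduce to
  \<open>(a h)' = b h\<close>.\<close>

definition "b x = 1 - 2 * Q x * c / (H x)^2 + 2 * (Q x)^2 / (H x)^3"

lemma source_deriv: "x \<in> {0<..<X} \<Longrightarrow> ((\<lambda>x. R (H x)) has_real_derivative b x * H' x) (at x)"
  using H_pos[of x] unfolding source_def b_def discharge_def
  by (auto intro!: derivative_eq_intros H_deriv simp: field_simps power2_eq_square power3_eq_cube)

lemma integral_H': "y \<in> {0..X} \<Longrightarrow> (H' has_integral (H y - m)) {0..y}"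
  using fundamental_theorem_of_calculus_interior[of 0 y H H'] continuous_on_subset[OF continuous_H] H_deriv
  by (auto simp: H0 has_real_derivative_iff_has_vector_derivative)

text \<open>The function \<open>R(H) = a(H) H'\<close> satisfies the same equation, since its
  derivative is \<open>b H'\<close>. Hence the quotient of \<open>a z\<close> by \<open>R\<close>,
  which is \<open>z / H'\<close> where \<open>a\<close> is nonzero, has derivative zero away from
  the sonic point.\<close>

lemma singular_ode_unique:
  fixes z :: "real \<Rightarrow> complex"
  assumes xs: "xs \<in> {0..X}" "H xs = s" and cont: "continuous_on {0..X} z"
    and ode: "\<And>x. x \<in> {0<..<X} \<Longrightarrow>
      ((\<lambda>x. of_real (a (H x)) * z x) has_vector_derivative of_real (b x) * z x) (at x)"
  shows "\<exists>\<kappa>. \<forall>x\<in>{0..X}. z x = \<kappa> * of_real (H' x)"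
proof -
  define y where "y x = z x / of_real (H' x)" for x
  have nz: "H' x \<noteq> 0" if "x \<in> {0..X}" for x using H'_pos[OF that] by simp
  have cy: "continuous_on {0..X} y"
    unfolding y_def using nz by (intro continuous_intros continuous_H' cont) auto
  have dy: "(y has_vector_derivative 0) (at x)" if x: "x \<in> {0<..<X}" and "x \<noteq> xs" for x
  proof -
    have "H x \<noteq> s"
      using strict_mono_on_eqD[OF mono, of x xs] that xs by auto
    then have ax: "a (H x) \<noteq> 0" using flux_deriv_eq_0_iff[OF _ s H_pos, of F x] F x by auto
    then have Rx: "R (H x) \<noteq> 0" using a_mult_H'[of x] nz[of x] x by auto
    have "((\<lambda>x. complex_of_real (1 / R (H x))) has_vector_derivative
        of_real (- (b x * H' x) / (R (H x))^2)) (at x)"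
      using Rx by (intro has_vector_derivative_of_real)
        (auto intro!: derivative_eq_intros source_deriv[OF x] simp: has_real_derivative_iff_has_vector_derivative[symmetric] power2_eq_square)
    then have "((\<lambda>x. (of_real (a (H x)) * z x) * complex_of_real (1 / R (H x))) has_vector_derivative
        (of_real (a (H x)) * z x) * of_real (- (b x * H' x) / (R (H x))^2)
        + (of_real (b x) * z x) * of_real (1 / R (H x))) (at x)"
      by (intro has_vector_derivative_mult ode x)
    moreover have "(of_real (a (H x)) * z x) * of_real (- (b x * H' x) / (R (H x))^2)
        + (of_real (b x) * z x) * of_real (1 / R (H x)) = 0"
    proof -
      have "a (H x) * (- (b x * H' x) / (R (H x))^2) + b x * (1 / R (H x))
          = b x * (R (H x) - a (H x) * H' x) / (R (H x))^2"
        using Rx by (simp add: field_simps power2_eq_square)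
      also have "\<dots> = 0" using a_mult_H'[of x] x by simp
      finally have "of_real (a (H x) * (- (b x * H' x) / (R (H x))^2) + b x * (1 / R (H x))) * z x = 0"
        by simp
      then show ?thesis unfolding of_real_add of_real_mult by (simp only: algebra_simps)
    qed
    ultimately have d: "((\<lambda>x. (of_real (a (H x)) * z x) * complex_of_real (1 / R (H x)))
        has_vector_derivative 0) (at x)" by simp
    \<comment> \<open>The identity with \<open>y\<close> cancels \<open>a (H x)\<close>, so the
      sonic point is removed.\<close>
    define S where "S = {0<..<X} - {xs}"
    have "open S" "x \<in> S" using that by (auto simp: S_def)
    moreover have "(of_real (a (H x)) * z x) * complex_of_real (1 / R (H x)) = y x" if "x \<in> S" for x
    proof -
      have x: "x \<in> {0..X}" using that by (auto simp: S_def)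
      have "H x \<noteq> s"
        using strict_mono_on_eqD[OF mono, of x xs] that xs by (auto simp: S_def)
      then have "a (H x) \<noteq> 0" using flux_deriv_eq_0_iff[OF _ s H_pos[OF x], of F] F by auto
      then show ?thesis using nz[OF x] unfolding y_def a_mult_H'[OF x, symmetric] by simp
    qed
    ultimately show ?thesis using has_vector_derivative_transform_within_open[OF d] by blast
  qed
  \<comment> \<open>Between \<open>x\<close> and \<open>xs\<close> the sonic point is only an end
    point, where continuity of \<open>y\<close> is enough for the fundamental theorem.\<close>
  have "y x = y xs" if x: "x \<in> {0..X}" for x
  proof -
    have "((\<lambda>_. 0) has_integral (y (max x xs) - y (min x xs))) {min x xs..max x xs}"
    proof (rule fundamental_theorem_of_calculus_interior)
      show "continuous_on {min x xs..max x xs} y"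
        using x xs(1) by (intro continuous_on_subset[OF cy]) auto
      show "(y has_vector_derivative 0) (at t)" if "t \<in> {min x xs<..<max x xs}" for t
        using that x xs(1) by (intro dy) (auto simp: min_def max_def split: if_splits)
    qed auto
    then have "y (max x xs) - y (min x xs) = 0" using has_integral_0 has_integral_unique by blast
    then show ?thesis by (auto simp: max_def min_def split: if_splits)
  qed
  then show ?thesis using nz by (intro exI[of _ "y xs"]) (auto simp: y_def field_simps)
qed

end

section \<open>Expansion of the determinant at the origin\<close>

lemma analytic_on_cell_continuous:
  assumes "analytic_on_cell X f" shows "continuous_on {0..X} f"
proof -
  obtain g where g: "g analytic_on (complex_of_real ` {0..X})" "\<And>x. x \<in> {0..X} \<Longrightarrow> f x = g (of_real x)"
    using assms unfolding analytic_on_cell_def by blast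
  have "continuous_on (complex_of_real ` {0..X}) g"
    using g(1) by (intro holomorphic_on_imp_continuous_on analytic_imp_holomorphic)
  then have "continuous_on {0..X} (\<lambda>x. g (of_real x))"
    by (rule continuous_on_compose2) (auto intro!: continuous_intros)
  then show ?thesis using g(2) continuous_on_cong by (metis (no_types, lifting))
qed

lemma open_spectral_domain: "open (spectral_domain F s)"
  unfolding spectral_domain_def by (simp add: open_halfspace_Re_gt)

lemma zero_in_spectral_domain: "F > 2 \<Longrightarrow> s > 0 \<Longrightarrow> 0 \<in> spectral_domain F s"
  by (simp add: spectral_domain_def divide_less_0_iff)

lemma Lim_endpoints:
  fixes f :: "real \<Rightarrow> complex"
  assumes "continuous_on {0..X} f" "X > 0"
  shows "Lim (at_left X) f = f X" "Lim (at_right 0) f = f 0"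
  using continuous_on_Icc_at_leftD[OF assms] continuous_on_Icc_at_rightD[OF assms]
  by (auto intro!: tendsto_Lim)

locale evans = roll_wave_profile +
  fixes xs :: real and h q :: "complex \<Rightarrow> real \<Rightarrow> complex"
  assumes xs: "0 < xs" "xs < X" "H xs = s"
    and sol: "normalized_solutions F s X H xs h q"
begin

abbreviation (input) "\<Omega> \<equiv> spectral_domain F s"
abbreviation (input) "w l \<equiv> lin_flux1 F s (h l) (q l)"
abbreviation (input) "\<phi> l \<equiv> lin_flux2 F s H (h l) (q l)"

definition "h1 x = deriv (\<lambda>l. h l x) 0"
definition "q1 x = deriv (\<lambda>l. q l x) 0"
definition "rhs l x = - l * q l x + h l x - of_real (2 * Q x / (H x)^2) * q l x
    + of_real (2 * (Q x)^2 / (H x)^3) * h l x"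

lemma \<Omega>0: "0 \<in> \<Omega>" using zero_in_spectral_domain F s by blast

lemma continuous_h: "l \<in> \<Omega> \<Longrightarrow> continuous_on {0..X} (h l)"
  and continuous_q: "l \<in> \<Omega> \<Longrightarrow> continuous_on {0..X} (q l)"
  using sol analytic_on_cell_continuous unfolding normalized_solutions_def by blast+

lemma holomorphic_h: "x \<in> {0..X} \<Longrightarrow> (\<lambda>l. h l x) holomorphic_on \<Omega>"
  and holomorphic_q: "x \<in> {0..X} \<Longrightarrow> (\<lambda>l. q l x) holomorphic_on \<Omega>"
  using sol unfolding normalized_solutions_def by blast+

lemma continuous_h_joint: "continuous_on (\<Omega> \<times> {0..X}) (\<lambda>(l, x). h l x)"
  and continuous_q_joint: "continuous_on (\<Omega> \<times> {0..X}) (\<lambda>(l, x). q l x)"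
  using sol unfolding normalized_solutions_def by blast+

lemma continuous_Q: "continuous_on {0..X} Q"
  unfolding discharge_def by (intro continuous_intros continuous_H)

lemma H_nonzero: "x \<in> {0..X} \<Longrightarrow> H x \<noteq> 0"
  using H_pos[of x] by simp

lemma continuous_w: "l \<in> \<Omega> \<Longrightarrow> continuous_on {0..X} (w l)"
  unfolding lin_flux1_def by (intro continuous_intros continuous_h continuous_q)

lemma continuous_\<phi>: "l \<in> \<Omega> \<Longrightarrow> continuous_on {0..X} (\<phi> l)"
  unfolding lin_flux2_def Let_def using F H_nonzero
  by (intro continuous_intros continuous_h continuous_q continuous_H continuous_Q) auto

lemma w_deriv: "l \<in> \<Omega> \<Longrightarrow> x \<in> {0<..<X} \<Longrightarrow> (w l has_vector_derivative - l * h l x) (at x)"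
proof -
  assume l: "l \<in> \<Omega>" and x: "x \<in> {0<..<X}"
  have "w l differentiable (at x)" and "l * h l x + vector_derivative (w l) (at x) = 0"
    using sol l x unfolding normalized_solutions_def eigenvalue_system_def Let_def by blast+
  moreover have "vector_derivative (w l) (at x) = - l * h l x"
    using calculation(2) by (simp add: eq_neg_iff_add_eq_0 add.commute)
  ultimately show ?thesis using vector_derivative_works by metis
qed

lemma \<phi>_deriv: "l \<in> \<Omega> \<Longrightarrow> x \<in> {0<..<X} \<Longrightarrow> (\<phi> l has_vector_derivative rhs l x) (at x)"
proof -
  assume l: "l \<in> \<Omega>" and x: "x \<in> {0<..<X}"
  have "\<phi> l differentiable (at x)"
    and "l * q l x + vector_derivative (\<phi> l) (at x)
      = h l x - of_real (2 * Q x / (H x)^2) * q l x + of_real (2 * (Q x)^2 / (H x)^3) * h l x"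
    using sol l x unfolding normalized_solutions_def eigenvalue_system_def Let_def by blast+
  moreover have "vector_derivative (\<phi> l) (at x) = rhs l x"
    using calculation(2) unfolding rhs_def by (simp add: algebra_simps eq_diff_eq)
  ultimately show ?thesis using vector_derivative_works by metis
qed

text \<open>The explicit factor \<open>l\<close> is what allows the determinant at
  \<open>xi = 0\<close> to be divided by \<open>l\<close> in closed form.\<close>

lemma w_integral:
  assumes "l \<in> \<Omega>" "y \<in> {0..X}"
  shows "w l y - w l 0 = - l * integral {0..y} (h l)"
proof -
  have "((\<lambda>x. - l * h l x) has_integral (w l y - w l 0)) {0..y}"
    using assms by (intro fundamental_theorem_of_calculus_interior
      continuous_on_subset[OF continuous_w[OF assms(1)]] w_deriv) auto
  moreover have "((\<lambda>x. - l * h l x) has_integral (- l * integral {0..y} (h l))) {0..y}"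
    using assms by (intro has_integral_mult_right integrable_integral integrable_continuous_real
      continuous_on_subset[OF continuous_h[OF assms(1)]]) auto
  ultimately show ?thesis by (rule has_integral_unique)
qed

lemma \<phi>_integral:
  assumes "l \<in> \<Omega>" "y \<in> {0..X}"
  shows "\<phi> l y - \<phi> l 0 = integral {0..y} (rhs l)"
proof -
  have "(rhs l has_integral (\<phi> l y - \<phi> l 0)) {0..y}"
    using assms by (intro fundamental_theorem_of_calculus_interior
      continuous_on_subset[OF continuous_\<phi>[OF assms(1)]] \<phi>_deriv) auto
  then show ?thesis by (simp add: integral_unique)
qed

lemma h_deriv: "x \<in> {0..X} \<Longrightarrow> ((\<lambda>l. h l x) has_field_derivative h1 x) (at 0)"
  and q_deriv: "x \<in> {0..X} \<Longrightarrow> ((\<lambda>l. q l x) has_field_derivative q1 x) (at 0)"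
  using holomorphic_derivI[OF holomorphic_h open_spectral_domain \<Omega>0]
    holomorphic_derivI[OF holomorphic_q open_spectral_domain \<Omega>0]
  unfolding h1_def q1_def by auto

lemma h_sonic: "l \<in> \<Omega> \<Longrightarrow> h l xs = of_real ((F - 2) / (2 * (F + 1)) * sqrt s)
                   * ((l + of_real (2/3 * (F + 1) / sqrt s)) * of_real F)"
  and q_sonic: "l \<in> \<Omega> \<Longrightarrow> q l xs = of_real ((F - 2) / (2 * (F + 1)) * sqrt s)
                   * (l * of_real (sqrt s * (F - 1)) + of_real (2/3 * (F + 1)^2))"
  using sol unfolding normalized_solutions_def by blast+

section \<open>The solution at \<lambda> = 0\<close>

lemma H'_sonic: "H' xs = F * (F - 2) / 3"
proof -
  have "H' xs = (s^2 * (F * (F - 2))) / (s^2 * 3)"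
    unfolding H'_def wave_slope_def xs(3) by (simp add: power2_eq_square algebra_simps)
  then show ?thesis using s by simp
qed

lemma h_sonic_0: "h 0 xs = of_real (H' xs)"
proof -
  have "F + 1 \<noteq> 0" using F by simp
  then have "(F - 2) / (2 * (F + 1)) * sqrt s * (2/3 * (F + 1) / sqrt s * F) = H' xs"
    using s by (simp add: H'_sonic)
  then show ?thesis unfolding h_sonic[OF \<Omega>0] by (simp only: add_0_left mult_zero_left flip: of_real_mult mult.assoc)
qed

lemma q_sonic_0: "q 0 xs = of_real (c * H' xs)"
proof -
  have "F + 1 \<noteq> 0" "1 + 1 / F = (F + 1) / F" using F by (simp_all add: field_simps)
  then have "(F - 2) / (2 * (F + 1)) * sqrt s * (2/3 * (F + 1)^2) = c * H' xs"
    unfolding H'_sonic speed_def \<open>1 + 1 / F = (F + 1) / F\<close> power2_eq_square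
    using F \<open>F + 1 \<noteq> 0\<close> by (simp add: nonzero_divide_eq_eq mult_ac)
  then show ?thesis unfolding q_sonic[OF \<Omega>0] by (simp only: add_0_left mult_zero_left flip: of_real_mult mult.assoc)
qed

text \<open>Inserting \<open>Q = c H - k\<close> isolates \<open>v - c u\<close>, the first flux,
  which is controlled by the first equation. The remainder is \<open>a u\<close>, so the degeneracy
  at the sonic point sits in the coefficient of \<open>u\<close> alone.\<close>

lemma \<phi>_eq: "x \<in> {0..X} \<Longrightarrow> lin_flux2 F s H u v x
    = of_real (a (H x)) * u x + of_real (2 * Q x / H x - c) * (v x - of_real c * u x)"
proof -
  assume x: "x \<in> {0..X}"
  have "- ((Q x)^2 / (H x)^2) + H x / F^2 = a (H x) - (2 * Q x / H x - c) * c"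
    using H_pos[OF x] unfolding flux_deriv_def discharge_def
    by (simp add: field_simps power2_eq_square)
  then show ?thesis unfolding lin_flux2_def Let_def
    by (simp only: of_real_diff of_real_mult) (simp only: algebra_simps)
qed

lemma b_eq: "of_real (b x) * u = (u - of_real (2 * Q x / (H x)^2) * (of_real c * u)
    + of_real (2 * (Q x)^2 / (H x)^3) * u :: complex)"
  unfolding b_def by (simp add: algebra_simps)

text \<open>At \<lambda> = 0 the first flux is constant, and the normalization makes it vanish at
  the sonic point.\<close>

lemma q_0: "x \<in> {0..X} \<Longrightarrow> q 0 x = of_real c * h 0 x"
proof -
  assume x: "x \<in> {0..X}"
  have "w 0 x - w 0 0 = 0" "w 0 xs - w 0 0 = 0"
    using w_integral[OF \<Omega>0, of x] w_integral[OF \<Omega>0, of xs] x xs by simp_all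
  then have "w 0 x = w 0 xs" by simp
  also have "\<dots> = 0" using h_sonic_0 q_sonic_0 by (simp add: lin_flux1_def)
  finally show ?thesis by (simp add: lin_flux1_def)
qed

lemma h_0: "x \<in> {0..X} \<Longrightarrow> h 0 x = of_real (H' x)"
proof -
  assume x: "x \<in> {0..X}"
  have "\<exists>\<kappa>. \<forall>x\<in>{0..X}. h 0 x = \<kappa> * of_real (H' x)"
  proof (rule singular_ode_unique)
    fix x assume x: "x \<in> {0<..<X}"
    have "rhs 0 x = of_real (b x) * h 0 x"
      unfolding b_eq rhs_def using x by (simp add: q_0)
    then have d: "(\<phi> 0 has_vector_derivative of_real (b x) * h 0 x) (at x)"
      using \<phi>_deriv[OF \<Omega>0 x] by simp
    have "\<phi> 0 y = of_real (a (H y)) * h 0 y" if "y \<in> {0<..<X}" for y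
      using that \<phi>_eq[of y "h 0" "q 0"] q_0[of y] by simp
    then show "((\<lambda>x. of_real (a (H x)) * h 0 x) has_vector_derivative of_real (b x) * h 0 x) (at x)"
      by (rule has_vector_derivative_transform_within_open[OF d open_greaterThanLessThan x])
  qed (use xs continuous_h[OF \<Omega>0] in auto)
  then obtain \<kappa> where \<kappa>: "\<And>x. x \<in> {0..X} \<Longrightarrow> h 0 x = \<kappa> * of_real (H' x)" by blast
  have "\<kappa> = 1" using \<kappa>[of xs] h_sonic_0 H'_pos[of xs] xs by simp
  then show ?thesis using \<kappa>[OF x] by simp
qed

lemma \<phi>_0: "x \<in> {0..X} \<Longrightarrow> \<phi> 0 x = of_real (R (H x))"
proof -
  assume x: "x \<in> {0..X}"
  have "\<phi> 0 x = of_real (a (H x) * H' x)"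
    unfolding \<phi>_eq[OF x] q_0[OF x] h_0[OF x] by simp
  then show ?thesis unfolding a_mult_H'[OF x] .
qed

section \<open>First order in \<lambda>\<close>

lemma obtain_ball: obtains \<rho> where "\<rho> > 0" "cball 0 \<rho> \<subseteq> \<Omega>"
  using open_spectral_domain \<Omega>0 open_contains_cball by blast

lemma continuous_h1: "continuous_on {0..X} h1" and continuous_q1: "continuous_on {0..X} q1"
proof -
  obtain \<rho> where \<rho>: "\<rho> > 0" "cball 0 \<rho> \<subseteq> \<Omega>" by (rule obtain_ball)
  have sub: "cball 0 \<rho> \<times> {0..X} \<subseteq> \<Omega> \<times> {0..X}" "ball 0 \<rho> \<subseteq> \<Omega>" using \<rho> ball_subset_cball[of 0 \<rho>] by auto
  have gen: "continuous_on {0..X} (\<lambda>x. deriv (\<lambda>l. f l x) 0)"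
    if "continuous_on (\<Omega> \<times> {0..X}) (\<lambda>(l, x). f l x)" "\<And>x. x \<in> {0..X} \<Longrightarrow> (\<lambda>l. f l x) holomorphic_on \<Omega>"
    for f :: "complex \<Rightarrow> real \<Rightarrow> complex"
  proof -
    have "continuous_on (ball 0 \<rho> \<times> {0..X}) (\<lambda>(l, x). deriv (\<lambda>l. f l x) l)"
      using that sub by (intro continuous_on_deriv_parametric)
        (auto intro: continuous_on_subset holomorphic_on_subset)
    then have "continuous_on {0..X} (\<lambda>x. (\<lambda>(l, x). deriv (\<lambda>l. f l x) l) (0, x))"
      by (rule continuous_on_compose2) (use \<rho>(1) in \<open>auto intro!: continuous_intros\<close>)
    then show ?thesis by simp
  qed
  show "continuous_on {0..X} h1" "continuous_on {0..X} q1"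
    unfolding h1_def q1_def
    by (intro gen continuous_h_joint continuous_q_joint holomorphic_h holomorphic_q; assumption)+
qed

lemma integral_deriv:
  assumes "y \<in> {0..X}" "continuous_on (\<Omega> \<times> {0..X}) (\<lambda>(l, x). f l x)"
    "\<And>x. x \<in> {0..X} \<Longrightarrow> (\<lambda>l. f l x) holomorphic_on \<Omega>"
  shows "((\<lambda>l. integral {0..y} (f l)) has_field_derivative integral {0..y} (\<lambda>x. deriv (\<lambda>l. f l x) 0)) (at 0)"
proof -
  obtain \<rho> where \<rho>: "\<rho> > 0" "cball 0 \<rho> \<subseteq> \<Omega>" by (rule obtain_ball)
  have sub: "cball 0 \<rho> \<times> {0..y} \<subseteq> \<Omega> \<times> {0..X}" "ball 0 \<rho> \<subseteq> \<Omega>"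
    using \<rho> ball_subset_cball[of 0 \<rho>] assms(1) by auto
  show ?thesis
    using assms(1) sub
    by (intro has_field_derivative_integral_parametric[OF \<rho>(1)] continuous_on_subset[OF assms(2)]
        holomorphic_on_subset[OF assms(3)]) auto
qed

text \<open>To first order in \<lambda> the first equation reads \<open>(q1 - c h1)' = - H'\<close>,
  so \<open>q1 - c h1 + H\<close> is constant, and the normalization at the sonic point gives the
  constant \<gamma>. Differentiating \<open>Q = c H - k\<close> in \<open>s\<close> agrees with
  this: there the corresponding quantity is \<open>c' H - k'\<close>, and it is divided by
  \<open>- c'\<close>.\<close>

lemma w1_eq: "y \<in> {0..X} \<Longrightarrow> q1 y - of_real c * h1 y = of_real (\<gamma> - H y)"
proof -
  assume y: "y \<in> {0..X}"
  have w1: "((\<lambda>l. w l x) has_field_derivative q1 x - of_real c * h1 x) (at 0)" if "x \<in> {0..X}" for x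
    unfolding lin_flux1_def by (auto intro!: derivative_eq_intros h_deriv[OF that] q_deriv[OF that])
  have diff: "q1 y - of_real c * h1 y - (q1 0 - of_real c * h1 0) = - of_real (H y - m)" if y: "y \<in> {0..X}" for y
  proof -
    have "((\<lambda>l. - l * integral {0..y} (h l)) has_field_derivative - integral {0..y} (h 0)) (at 0)"
      using integral_deriv[OF y continuous_h_joint holomorphic_h]
      by (auto intro!: derivative_eq_intros)
    moreover have "((\<lambda>l. w l y - w l 0) has_field_derivative
        q1 y - of_real c * h1 y - (q1 0 - of_real c * h1 0)) (at 0)"
      using X by (intro DERIV_diff w1 y) auto
    then have "((\<lambda>l. - l * integral {0..y} (h l)) has_field_derivative
        q1 y - of_real c * h1 y - (q1 0 - of_real c * h1 0)) (at 0)"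
      by (rule has_field_derivative_transform_within_open[OF _ open_spectral_domain \<Omega>0])
        (use w_integral y in auto)
    ultimately have "q1 y - of_real c * h1 y - (q1 0 - of_real c * h1 0) = - integral {0..y} (h 0)"
      using DERIV_unique by blast
    moreover have "integral {0..y} (h 0) = integral {0..y} (\<lambda>x. complex_of_real (H' x))"
      using y by (intro integral_cong) (auto simp: h_0)
    moreover have "((\<lambda>x. complex_of_real (H' x)) has_integral of_real (H y - m)) {0..y}"
      using integral_H'[OF y] by (rule has_integral_of_real)
    ultimately show ?thesis by (simp add: integral_unique)
  qed
  have xs': "xs \<in> {0..X}" using xs by auto
  have "q1 xs - of_real c * h1 xs = of_real (\<gamma> - s)"
  proof -
    define K where "K = (F - 2) / (2 * (F + 1)) * sqrt s"
    have "((\<lambda>l. of_real K * ((l + of_real (2/3 * (F + 1) / sqrt s)) * of_real F)) has_field_derivative of_real (K * F)) (at 0)"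
      by (auto intro!: derivative_eq_intros)
    then have "((\<lambda>l. h l xs) has_field_derivative of_real (K * F)) (at 0)"
      by (rule has_field_derivative_transform_within_open[OF _ open_spectral_domain \<Omega>0])
        (auto simp: h_sonic K_def)
    then have h: "h1 xs = of_real (K * F)" using h_deriv[OF xs'] DERIV_unique by blast
    have "((\<lambda>l. of_real K * (l * of_real (sqrt s * (F - 1)) + of_real (2/3 * (F + 1)^2))) has_field_derivative of_real (K * (sqrt s * (F - 1)))) (at 0)"
      by (auto intro!: derivative_eq_intros)
    then have "((\<lambda>l. q l xs) has_field_derivative of_real (K * (sqrt s * (F - 1)))) (at 0)"
      by (rule has_field_derivative_transform_within_open[OF _ open_spectral_domain \<Omega>0])
        (auto simp: q_sonic K_def)
    then have q: "q1 xs = of_real (K * (sqrt s * (F - 1)))" using q_deriv[OF xs'] DERIV_unique by blast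
    have "c * F = sqrt s * (F + 1)" using F by (simp add: speed_def field_simps)
    then have "K * (sqrt s * (F - 1)) - c * (K * F) = - (2 * K * sqrt s)" by algebra
    also have "2 * K = (F - 2) / (F + 1) * sqrt s"
    proof -
      have "F + 1 \<noteq> 0" "2 * (F + 1) \<noteq> 0" using F by simp_all
      then show ?thesis by (simp add: K_def nonzero_divide_eq_eq nonzero_eq_divide_eq)
    qed
    also have "- ((F - 2) / (F + 1) * sqrt s * sqrt s) = - ((F - 2) / (F + 1)) * (sqrt s * sqrt s)"
      by simp
    also have "\<dots> = \<gamma> - s" using F s by (simp add: \<gamma>_def field_simps)
    finally show ?thesis unfolding h q by (simp flip: of_real_mult of_real_diff)
  qed
  moreover note diff[OF y] diff[OF xs']
  ultimately show ?thesis unfolding xs(3) of_real_diff by algebra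
qed

text \<open>At fixed \<open>F\<close> the waves with sonic point \<open>xs\<close> are the rescalings \<open>s K((x - xs) / s)\<close> of one
  another. Since the speed varies with \<open>s\<close>, the \<open>s\<close>-derivative \<open>(H - (x - xs) H') / s\<close> of the profile
  is a generalized eigenfunction at \<open>\<lambda> = 0\<close>; divided by \<open>- c'\<close> it is \<open>g\<close>.\<close>

definition "g x = - \<beta> * (H x - (x - xs) * H' x)"
definition "\<Phi> x = (2 * Q x / H x - c) * (\<gamma> - H x) - \<beta> * (a (H x) * H x - (x - xs) * R (H x))"

text \<open>In the definition \<open>a H'\<close> is replaced by \<open>R\<close>, so that
  differentiating \<Phi> does not involve the second derivative of the profile.\<close>

lemma \<Phi>_eq: "x \<in> {0..X} \<Longrightarrow> \<Phi> x = (2 * Q x / H x - c) * (\<gamma> - H x) + a (H x) * g x"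
  unfolding \<Phi>_def g_def by (simp add: a_mult_H'[symmetric] algebra_simps)

text \<open>This is the second equation at first order in \<lambda>, with \<open>g\<close> for
  \<open>h1\<close> and \<open>c g + \<gamma> - H\<close> for \<open>q1\<close>. It balances because
  of the homogeneity relations \<open>\<beta>_c\<close> and \<open>\<beta>_k\<close>.\<close>

lemma \<Phi>_deriv:
  assumes x: "x \<in> {0<..<X}"
  shows "(\<Phi> has_real_derivative - c * H' x + b x * g x - 2 * Q x / (H x)^2 * (\<gamma> - H x)) (at x)"
proof -
  have Hx: "H x > 0" using H_pos x by auto
  have d: "(\<Phi> has_real_derivative
      (2 * k / (H x)^2 * H' x) * (\<gamma> - H x) + (c - 2 * k / H x) * (- H' x)
      - \<beta> * ((2 * H x / F^2 + k^2 / (H x)^2) * H' x - (R (H x) + (x - xs) * (b x * H' x)))) (at x)"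
  proof -
    \<comment> \<open>A form of \<Phi> that is easier to differentiate:
      \<open>2 Q / H - c = c - 2 k / H\<close> and
      \<open>a(H) H = H^2 / F^2 - k^2 / H\<close>.\<close>
    have "((\<lambda>x. (c - 2 * k / H x) * (\<gamma> - H x) - \<beta> * ((H x)^2 / F^2 - k^2 / H x - (x - xs) * R (H x))) has_real_derivative
      (2 * k / (H x)^2 * H' x) * (\<gamma> - H x) + (c - 2 * k / H x) * (- H' x)
      - \<beta> * ((2 * H x / F^2 + k^2 / (H x)^2) * H' x - (R (H x) + (x - xs) * (b x * H' x)))) (at x)"
      using Hx F by (auto intro!: derivative_eq_intros H_deriv[OF x] source_deriv[OF x]
          simp: power2_eq_square field_simps)
    then show ?thesis
    proof (rule DERIV_cong_ev[THEN iffD1, rotated -1])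
      have "\<forall>\<^sub>F y in nhds x. y \<in> {0<..<X}" using x by (intro eventually_nhds_in_open) auto
      then show "\<forall>\<^sub>F x in nhds x. (c - 2 * k / H x) * (\<gamma> - H x) - \<beta> * ((H x)^2 / F^2 - k^2 / H x - (x - xs) * R (H x)) = \<Phi> x"
      proof eventually_elim
        case (elim y)
        then have "H y > 0" using H_pos by auto
        then show ?case unfolding \<Phi>_def flux_deriv_def discharge_def
          by (simp add: field_simps power2_eq_square)
      qed
    qed auto
  qed
  have Rx: "R (H x) = (H x / F^2 - k^2 / (H x)^2) * H' x"
    using a_mult_H'[of x] x by (simp add: flux_deriv_def)
  have "(2 * k / (H x)^2 * H' x) * (\<gamma> - H x) + (c - 2 * k / H x) * (- H' x)
      - \<beta> * ((2 * H x / F^2 + k^2 / (H x)^2) * H' x - (R (H x) + (x - xs) * (b x * H' x)))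
     = H' x * (2 * \<gamma> * k / (H x)^2 - c - \<beta> * (2 * H x / F^2 + k^2 / (H x)^2)) + \<beta> * R (H x)
      + \<beta> * (x - xs) * (b x * H' x)"
    using Hx by (simp add: field_simps power2_eq_square)
  also have "2 * \<gamma> * k / (H x)^2 = 3 * \<beta> * k^2 / (H x)^2"
    using \<beta>_k by (simp add: power2_eq_square algebra_simps)
  also have "H' x * (3 * \<beta> * k^2 / (H x)^2 - c - \<beta> * (2 * H x / F^2 + k^2 / (H x)^2)) + \<beta> * R (H x)
      + \<beta> * (x - xs) * (b x * H' x) = - c * H' x + \<beta> * (x - xs) * (b x * H' x) + (- \<beta> * R (H x))"
    unfolding Rx by (simp add: algebra_simps add_divide_distrib diff_divide_distrib)
  \<comment> \<open>The difference \<open>\<beta> H b - \<beta> R\<close> is \<open>Q / H^2\<close>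
    times an expression linear in \<open>H\<close>, which \<open>\<beta>_c\<close> and
    \<open>\<beta>_k\<close> identify as \<open>- 2 (\<gamma> - H)\<close>.\<close>
  also have "- \<beta> * R (H x) = - \<beta> * H x * b x - 2 * Q x / (H x)^2 * (\<gamma> - H x)"
  proof -
    have "\<beta> * H x * b x - \<beta> * R (H x) = Q x / (H x)^2 * (3 * \<beta> * Q x - 2 * (\<beta> * c) * H x)"
      using Hx unfolding b_def source_def discharge_def[symmetric]
      by (simp add: field_simps power2_eq_square power3_eq_cube)
    also have "3 * \<beta> * Q x - 2 * (\<beta> * c) * H x = (\<beta> * c) * H x - 3 * (\<beta> * k)"
      unfolding discharge_def by (simp add: algebra_simps)
    also have "\<dots> = - 2 * (\<gamma> - H x)" unfolding \<beta>_c \<beta>_k by simp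
    finally have "\<beta> * H x * b x - \<beta> * R (H x) = Q x / (H x)^2 * (- 2 * (\<gamma> - H x))" .
    moreover have "Q x / (H x)^2 * (- 2 * (\<gamma> - H x)) = - (2 * Q x / (H x)^2 * (\<gamma> - H x))"
      by (simp only: times_divide_eq_left times_divide_eq_right minus_divide_left) (simp add: algebra_simps)
    moreover have "- v = - u - e" if "u - v = d" "d = - e" for u v d e :: real using that by simp
    ultimately show ?thesis unfolding mult_minus_left by blast
  qed
  also have "- c * H' x + \<beta> * (x - xs) * (b x * H' x) + (- \<beta> * H x * b x - 2 * Q x / (H x)^2 * (\<gamma> - H x))
      = - c * H' x + b x * g x - 2 * Q x / (H x)^2 * (\<gamma> - H x)"
    unfolding g_def by algebra
  finally show ?thesis using d by (rule back_subst[of "\<lambda>D. (\<Phi> has_real_derivative D) (at x)", rotated])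
qed

definition "rhs1 x = - q 0 x + h1 x - of_real (2 * Q x / (H x)^2) * q1 x
    + of_real (2 * (Q x)^2 / (H x)^3) * h1 x"
definition "\<phi>1 x = of_real (a (H x)) * h1 x + of_real (2 * Q x / H x - c) * of_real (\<gamma> - H x)"

lemma \<phi>_param_deriv: "x \<in> {0..X} \<Longrightarrow> ((\<lambda>l. \<phi> l x) has_field_derivative \<phi>1 x) (at 0)"
  unfolding \<phi>_eq \<phi>1_def w1_eq[symmetric]
  by (auto intro!: derivative_eq_intros h_deriv q_deriv)

lemma rhs_param_deriv: "x \<in> {0..X} \<Longrightarrow> ((\<lambda>l. rhs l x) has_field_derivative rhs1 x) (at 0)"
proof -
  assume x: "x \<in> {0..X}"
  have "((\<lambda>l. - l * q l x + h l x - u * q l x + v * h l x) has_field_derivative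
      - q 0 x + h1 x - u * q1 x + v * h1 x) (at 0)" for u v
    by (auto intro!: derivative_eq_intros h_deriv[OF x] q_deriv[OF x])
  then show ?thesis unfolding rhs_def rhs1_def by blast
qed

lemma continuous_rhs1: "continuous_on {0..X} rhs1"
  unfolding rhs1_def using H_nonzero \<Omega>0
  by (intro continuous_intros continuous_h1 continuous_q1 continuous_q continuous_H continuous_Q) auto

text \<open>The second equation is differentiated in \<lambda> in integrated form, where joint
  continuity justifies the interchange; \<open>\<phi>1_deriv\<close> then returns to a differential
  equation.\<close>

lemma \<phi>1_integral: "y \<in> {0..X} \<Longrightarrow> \<phi>1 y - \<phi>1 0 = integral {0..y} rhs1"
proof -
  assume y: "y \<in> {0..X}"
  have H2: "continuous_on (\<Omega> \<times> {0..X}) (\<lambda>z. H (snd z))" "continuous_on (\<Omega> \<times> {0..X}) (\<lambda>z. Q (snd z))"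
    by (auto intro!: continuous_on_compose2[OF continuous_H] continuous_on_compose2[OF continuous_Q] continuous_intros)
  have "continuous_on (\<Omega> \<times> {0..X}) (\<lambda>z. rhs (fst z) (snd z))"
    using continuous_h_joint continuous_q_joint H_nonzero unfolding rhs_def case_prod_unfold
    by (intro continuous_intros H2) auto
  then have "((\<lambda>l. integral {0..y} (rhs l)) has_field_derivative
      integral {0..y} (\<lambda>x. deriv (\<lambda>l. rhs l x) 0)) (at 0)"
    using holomorphic_h holomorphic_q unfolding rhs_def
    by (intro integral_deriv[OF y]) (auto simp: case_prod_unfold intro!: holomorphic_intros)
  moreover have "integral {0..y} (\<lambda>x. deriv (\<lambda>l. rhs l x) 0) = integral {0..y} rhs1"
    using y by (intro integral_cong DERIV_imp_deriv rhs_param_deriv) auto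
  moreover have "((\<lambda>l. \<phi> l y - \<phi> l 0) has_field_derivative \<phi>1 y - \<phi>1 0) (at 0)"
    using X y by (intro DERIV_diff \<phi>_param_deriv) auto
  then have "((\<lambda>l. integral {0..y} (rhs l)) has_field_derivative \<phi>1 y - \<phi>1 0) (at 0)"
    by (rule has_field_derivative_transform_within_open[OF _ open_spectral_domain \<Omega>0])
      (use \<phi>_integral y in auto)
  ultimately show ?thesis using DERIV_unique by metis
qed

lemma \<phi>1_deriv: "x \<in> {0<..<X} \<Longrightarrow> (\<phi>1 has_vector_derivative rhs1 x) (at x)"
proof -
  assume x: "x \<in> {0<..<X}"
  have "((\<lambda>y. integral {0..y} rhs1) has_vector_derivative rhs1 x) (at x within {0..X})"
    using integral_has_vector_derivative[OF continuous_rhs1] x by simp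
  then have "((\<lambda>y. integral {0..y} rhs1) has_vector_derivative rhs1 x) (at x)"
    using at_within_interior[of x "{0..X}"] x by simp
  then have "((\<lambda>y. \<phi>1 0 + integral {0..y} rhs1) has_vector_derivative rhs1 x) (at x)"
    by (auto intro!: derivative_eq_intros)
  then show ?thesis
  proof (rule has_vector_derivative_transform_within_open[OF _ open_greaterThanLessThan x])
    fix y assume "y \<in> {0<..<X}"
    then show "\<phi>1 0 + integral {0..y} rhs1 = \<phi>1 y" using \<phi>1_integral[of y, symmetric] by simp
  qed
qed

text \<open>Both \<open>h1\<close> and \<open>g\<close> solve the inhomogeneous first-order
  equation, so their difference solves the homogeneous singular one. The factor \<kappa> stays
  undetermined, as it cancels in \<open>deriv_A_0\<close>.\<close>

lemma h1_eq: "\<exists>\<kappa>. \<forall>x\<in>{0..X}. h1 x = of_real (g x) + \<kappa> * of_real (H' x)"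
proof -
  have "\<exists>\<kappa>. \<forall>x\<in>{0..X}. h1 x - of_real (g x) = \<kappa> * of_real (H' x)"
  proof (rule singular_ode_unique)
    show "continuous_on {0..X} (\<lambda>x. h1 x - of_real (g x))"
      unfolding g_def by (intro continuous_intros continuous_h1 continuous_H continuous_H')
    fix x assume x: "x \<in> {0<..<X}"
    have "((\<lambda>x. \<phi>1 x - of_real (\<Phi> x)) has_vector_derivative
        rhs1 x - of_real (- c * H' x + b x * g x - 2 * Q x / (H x)^2 * (\<gamma> - H x))) (at x)"
      using \<Phi>_deriv[OF x] by (intro has_vector_derivative_diff \<phi>1_deriv x has_vector_derivative_of_real)
        (simp add: has_real_derivative_iff_has_vector_derivative)
    moreover have "rhs1 x - of_real (- c * H' x + b x * g x - 2 * Q x / (H x)^2 * (\<gamma> - H x))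
        = of_real (b x) * (h1 x - of_real (g x))"
    proof -
      have x': "x \<in> {0..X}" using x by simp
      have q1: "q1 x = of_real c * h1 x + of_real (\<gamma> - H x)" using w1_eq[OF x'] by (simp add: algebra_simps)
      have "of_real (b x) * h1 x = h1 x - of_real (2 * Q x / (H x)^2) * (of_real c * h1 x)
          + of_real (2 * (Q x)^2 / (H x)^3) * h1 x" by (rule b_eq)
      then show ?thesis unfolding rhs1_def q1 q_0[OF x'] h_0[OF x']
          of_real_diff of_real_add of_real_mult[of "b x"] of_real_mult[of "2 * Q x / (H x)^2"]
          of_real_mult[of "- c"] of_real_minus
        by algebra
    qed
    ultimately have d: "((\<lambda>x. \<phi>1 x - of_real (\<Phi> x)) has_vector_derivative
        of_real (b x) * (h1 x - of_real (g x))) (at x)" by simp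
    show "((\<lambda>x. of_real (a (H x)) * (h1 x - of_real (g x))) has_vector_derivative
        of_real (b x) * (h1 x - of_real (g x))) (at x)"
    proof (rule has_vector_derivative_transform_within_open[OF d open_greaterThanLessThan x])
      fix y assume "y \<in> {0<..<X}"
      then have y: "y \<in> {0..X}" by simp
      show "\<phi>1 y - of_real (\<Phi> y) = of_real (a (H y)) * (h1 y - of_real (g y))"
        unfolding \<phi>1_def \<Phi>_eq[OF y] by (simp only: of_real_add of_real_mult) (simp only: algebra_simps)
    qed
  qed (use xs in auto)
  then obtain \<kappa> where "\<And>x. x \<in> {0..X} \<Longrightarrow> h1 x - of_real (g x) = \<kappa> * of_real (H' x)" by blast
  then show ?thesis by (intro exI[of _ \<kappa>]) (auto simp: algebra_simps)
qed

text \<open>By \<open>\<beta>_k\<close> the terms with \<gamma> and those from \<open>a(H) H\<close>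
  combine to \<open>- 2 \<beta>\<close> times the difference of the two sides of the jump condition,
  which is zero.\<close>

lemma \<Phi>_jump: "\<Phi> X - \<Phi> 0 = \<beta> * ((X - xs) * R P + xs * R m) - c * (P - m)"
proof -
  have mP: "m > 0" "P > 0" using m sP s by auto
  have flux: "2 * (c * y - k) / y - c = c - 2 * k * (1 / y)" "a y * y = y^2 / F^2 - k^2 * (1 / y)"
    "y * (1 / y) = 1" if y: "y > 0" for y
  proof -
    show "2 * (c * y - k) / y - c = c - 2 * k * (1 / y)"
      using y by (simp add: diff_divide_distrib right_diff_distrib)
    show "a y * y = y^2 / F^2 - k^2 * (1 / y)"
      using y by (simp add: flux_deriv_def left_diff_distrib power2_eq_square)
  qed (use y in simp)
  have "\<Phi> X - \<Phi> 0 - (\<beta> * ((X - xs) * R P + xs * R m) - c * (P - m))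
      = - (2 * \<gamma>) * k * (1 / P - 1 / m)
        - \<beta> * (P^2 / F^2 - k^2 * (1 / P) - (m^2 / F^2 - k^2 * (1 / m)))"
    unfolding \<Phi>_def H0 HX Q_0 Q_X flux(1,2)[OF mP(1)] flux(1,2)[OF mP(2)]
    using flux(3)[OF mP(1)] flux(3)[OF mP(2)] by algebra
  also have "\<dots> = - 2 * \<beta> * ((k^2 * (1 / P) + P^2 / F^2 / 2) - (k^2 * (1 / m) + m^2 / F^2 / 2))"
    unfolding \<beta>_k[symmetric] by algebra
  also have "\<dots> = 0" using RH by (simp add: mult.commute[of _ "F\<^sup>2"])
  finally show ?thesis by simp
qed

text \<open>Integration by parts: \<open>H - (x - xs) H'\<close> is \<open>2 H\<close> minus the
  derivative of \<open>(x - xs) H\<close>.\<close>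

lemma integral_g: "integral {0..X} g = - \<beta> * (2 * mass - (X - xs) * P - xs * m)"
proof -
  have "((\<lambda>x. H x + (x - xs) * H' x) has_integral ((X - xs) * H X - (0 - xs) * H 0)) {0..X}"
  proof (rule fundamental_theorem_of_calculus_interior)
    show "continuous_on {0..X} (\<lambda>x. (x - xs) * H x)" by (intro continuous_intros continuous_H)
    fix x assume "x \<in> {0<..<X}"
    then show "((\<lambda>x. (x - xs) * H x) has_vector_derivative H x + (x - xs) * H' x) (at x)"
      unfolding has_real_derivative_iff_has_vector_derivative[symmetric]
      by (auto intro!: derivative_eq_intros H_deriv)
  qed (use X in auto)
  then have "((\<lambda>x. - \<beta> * (2 * H x - (H x + (x - xs) * H' x))) has_integral
      - \<beta> * (2 * mass - ((X - xs) * H X - (0 - xs) * H 0))) {0..X}"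
    unfolding mass_def by (intro has_integral_mult_right has_integral_diff integrable_integral integrable_H)
  moreover have "(\<lambda>x. - \<beta> * (2 * H x - (H x + (x - xs) * H' x))) = g" by (auto simp: g_def)
  ultimately show ?thesis by (simp add: integral_unique H0 HX algebra_simps)
qed

section \<open>The determinant and its two cofactors\<close>

lemma evans_lopatinsky_eq:
  assumes "l \<in> \<Omega>"
  shows "evans_lopatinsky F s X H h q l xi =
     l * of_real (P - m) * (\<phi> l X - exp (\<i> * of_real (xi * X)) * \<phi> l 0)
     - (w l X - exp (\<i> * of_real (xi * X)) * w l 0) * (l * of_real (c * (P - m)) - of_real \<delta>)"
proof -
  have c1: "continuous_on {0..X} (\<lambda>x. l * complex_of_real (H x))"
    by (intro continuous_intros continuous_H)
  have c2: "continuous_on {0..X} (\<lambda>x. l * complex_of_real (Q x) - of_real (H x - (Q x)^2 / (H x)^2))"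
    using H_nonzero by (intro continuous_intros continuous_H continuous_Q) auto
  show ?thesis
    unfolding evans_lopatinsky_def Let_def jump_def bloch_jump_def det_2 vector_2
      Lim_endpoints[OF c1 X] Lim_endpoints[OF c2 X] Lim_endpoints[OF continuous_w[OF assms] X]
      Lim_endpoints[OF continuous_\<phi>[OF assms] X] Q_0 Q_X H0 HX \<delta>_def source_def
    by (simp add: algebra_simps)
qed

context
  fixes Dhat :: "complex \<Rightarrow> real \<Rightarrow> complex"
  assumes Dhat: "is_reduced_determinant F s X (evans_lopatinsky F s X H h q) Dhat"
begin

definition "A l = Dhat l 0"

text \<open>Since the determinant is affine in \<open>exp (i xi X)\<close>, the values at \<open>xi = 0\<close> and
  \<open>xi = pi / X\<close>, where the exponential is \<open>1\<close> and \<open>-1\<close>, determine it.\<close>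

definition "B l = (Dhat l (pi / X) - Dhat l 0) / 2"

lemma Dhat_eq: "xi \<in> {-pi/X..pi/X} \<Longrightarrow> l \<in> \<Omega> \<Longrightarrow> evans_lopatinsky F s X H h q l xi = l * Dhat l xi"
  and Dhat_holomorphic: "xi \<in> {-pi/X..pi/X} \<Longrightarrow> (\<lambda>l. Dhat l xi) holomorphic_on \<Omega>"
  using Dhat unfolding is_reduced_determinant_def by blast+

lemma xi_range: "0 \<in> {-pi/X..pi/X}" "pi / X \<in> {-pi/X..pi/X}"
  using X pi_ge_zero by (auto simp: divide_right_mono)

lemma A_holomorphic: "A holomorphic_on \<Omega>" and B_holomorphic: "B holomorphic_on \<Omega>"
  unfolding A_def B_def using xi_range by (auto intro!: holomorphic_intros Dhat_holomorphic)

lemma A_eq: "l \<in> \<Omega> \<Longrightarrow> l * A l = l * of_real (P - m) * (\<phi> l X - \<phi> l 0)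
     - (w l X - w l 0) * (l * of_real (c * (P - m)) - of_real \<delta>)"
  using Dhat_eq[OF xi_range(1), of l] evans_lopatinsky_eq[of l 0] by (simp add: A_def)

lemma B_eq: "l \<in> \<Omega> \<Longrightarrow> l * B l = l * of_real (P - m) * \<phi> l 0
     - w l 0 * (l * of_real (c * (P - m)) - of_real \<delta>)"
proof -
  assume l: "l \<in> \<Omega>"
  have affine: "p * (x + y) - (u + v) * z - (p * (x - y) - (u - v) * z) = 2 * (p * y - v * z)"
    for p x y u v z :: complex by (simp add: algebra_simps)
  have "evans_lopatinsky F s X H h q l (pi / X) =
     l * of_real (P - m) * (\<phi> l X + \<phi> l 0)
     - (w l X + w l 0) * (l * of_real (c * (P - m)) - of_real \<delta>)"
    using evans_lopatinsky_eq[OF l, of "pi / X"] X by simp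
  then have D: "l * Dhat l (pi / X) = l * of_real (P - m) * (\<phi> l X + \<phi> l 0)
     - (w l X + w l 0) * (l * of_real (c * (P - m)) - of_real \<delta>)"
    unfolding Dhat_eq[OF xi_range(2) l] .
  have "2 * (l * B l) = l * Dhat l (pi / X) - l * A l"
    unfolding A_def B_def by (simp flip: right_diff_distrib)
  also have "\<dots> = 2 * (l * of_real (P - m) * \<phi> l 0
     - w l 0 * (l * of_real (c * (P - m)) - of_real \<delta>))"
    unfolding D A_eq[OF l] by (rule affine)
  finally show ?thesis unfolding mult_cancel_left by simp
qed

lemma evans_lopatinsky_split:
  assumes "l \<in> \<Omega>"
  shows "evans_lopatinsky F s X H h q l xi = l * (A l + (1 - exp (\<i> * of_real (xi * X))) * B l)"
proof -
  have affine: "p * (x - e * y) - (u - e * v) * z = p * (x - y) - (u - v) * z + (1 - e) * (p * y - v * z)"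
    for p x y u v z e :: complex by (simp add: algebra_simps)
  have e: "l * (A l + (1 - exp (\<i> * of_real (xi * X))) * B l)
      = l * A l + (1 - exp (\<i> * of_real (xi * X))) * (l * B l)" by (simp add: algebra_simps)
  show ?thesis
    unfolding evans_lopatinsky_eq[OF assms] e A_eq[OF assms] B_eq[OF assms] by (rule affine)
qed

text \<open>Division by \<open>l\<close> gives the identity off 0, and continuity of both sides
  carries it to 0.\<close>

lemma Dhat_0_eq:
  assumes "xi \<in> {-pi/X..pi/X}"
  shows "Dhat 0 xi = A 0 + (1 - exp (\<i> * of_real (xi * X))) * B 0"
proof (rule isCont_eq_limit[where f="\<lambda>l. Dhat l xi"])
  have "(\<lambda>l. A l + (1 - exp (\<i> * of_real (xi * X))) * B l) holomorphic_on \<Omega>"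
    by (intro holomorphic_intros A_holomorphic B_holomorphic)
  then show "isCont (\<lambda>l. Dhat l xi) 0" "isCont (\<lambda>l. A l + (1 - exp (\<i> * of_real (xi * X))) * B l) 0"
    using Dhat_holomorphic[OF assms] open_spectral_domain \<Omega>0
    by (auto dest!: holomorphic_on_imp_continuous_on simp: continuous_on_eq_continuous_at)
  show "\<forall>\<^sub>F l in at 0. Dhat l xi = A l + (1 - exp (\<i> * of_real (xi * X))) * B l"
    using eventually_at_in_open[OF open_spectral_domain \<Omega>0]
  proof eventually_elim
    case (elim l)
    then show ?case using Dhat_eq[OF assms, of l] evans_lopatinsky_split[of l xi] by simp
  qed
qed

text \<open>By the product rule \<open>B 0\<close> is the derivative of \<open>l * B l\<close> at 0,
  so differentiating \<open>B_eq\<close> replaces a division by \<open>l\<close>.\<close>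

lemma B_0: "B 0 = of_real (P * R m - m * R P + \<gamma> * \<delta>)"
proof -
  have X0: "0 \<in> {0..X}" using X by simp
  have "((\<lambda>l. l * B l) has_field_derivative B 0) (at 0)"
    using holomorphic_derivI[OF B_holomorphic open_spectral_domain \<Omega>0] by (auto intro!: derivative_eq_intros)
  then have "((\<lambda>l. l * of_real (P - m) * \<phi> l 0 - w l 0 * (l * of_real (c * (P - m)) - of_real \<delta>))
      has_field_derivative B 0) (at 0)"
    by (rule has_field_derivative_transform_within_open[OF _ open_spectral_domain \<Omega>0]) (rule B_eq)
  moreover have "((\<lambda>l. w l 0) has_field_derivative of_real (\<gamma> - m)) (at 0)"
    unfolding lin_flux1_def using w1_eq[OF X0, symmetric, unfolded H0]
    by (auto intro!: derivative_eq_intros h_deriv q_deriv simp: X0[simplified])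
  then have "((\<lambda>l. l * of_real (P - m) * \<phi> l 0 - w l 0 * (l * of_real (c * (P - m)) - of_real \<delta>))
      has_field_derivative (of_real (P - m) * \<phi> 0 0
        - (of_real (\<gamma> - m) * (- of_real \<delta>) + of_real (c * (P - m)) * w 0 0))) (at 0)"
    by (auto intro!: derivative_eq_intros \<phi>_param_deriv[OF X0] simp: algebra_simps)
  ultimately have "B 0 = of_real (P - m) * \<phi> 0 0
        - (of_real (\<gamma> - m) * (- of_real \<delta>) + of_real (c * (P - m)) * w 0 0)"
    using DERIV_unique by blast
  moreover have "w 0 0 = 0" using q_0[OF X0] by (simp add: lin_flux1_def)
  moreover have "\<phi> 0 0 = of_real (R m)" using \<phi>_0[OF X0] by (simp add: H0)
  ultimately have "B 0 = of_real ((P - m) * R m - (\<gamma> - m) * (- \<delta>))" by simp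
  also have "(P - m) * R m - (\<gamma> - m) * (- \<delta>) = P * R m - m * R P + \<gamma> * \<delta>"
    by (simp add: \<delta>_def algebra_simps)
  finally show ?thesis .
qed

lemma deriv_A_0: "deriv A 0 = of_real (\<beta> * (2 * mass * \<delta> + X * (P * R m - m * R P)))"
proof -
  have X0: "0 \<in> {0..X}" "X \<in> {0..X}" using X by auto
  \<comment> \<open>The function \<open>A\<close> with the jump of the first flux replaced by
    \<open>- l\<close> times the integral of \<open>h\<close>, so that \<open>l\<close> has
    cancelled.\<close>
  define A' where "A' l = of_real (P - m) * (\<phi> l X - \<phi> l 0)
      + integral {0..X} (h l) * (l * of_real (c * (P - m)) - of_real \<delta>)" for l
  have dA': "(A' has_field_derivative of_real (P - m) * (\<phi>1 X - \<phi>1 0)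
      + (integral {0..X} h1 * (- of_real \<delta>) + of_real (c * (P - m)) * integral {0..X} (h 0))) (at 0)"
    unfolding A'_def h1_def using integral_deriv[OF X0(2) continuous_h_joint holomorphic_h]
    by (auto intro!: derivative_eq_intros \<phi>_param_deriv[OF X0(1)] \<phi>_param_deriv[OF X0(2)] simp: algebra_simps)
  have eq: "A l = A' l" if "l \<in> \<Omega>" "l \<noteq> 0" for l
  proof -
    have "l * A l = l * A' l"
      unfolding A_eq[OF that(1)] A'_def w_integral[OF that(1) X0(2)] by (simp add: algebra_simps)
    then show ?thesis using that(2) by simp
  qed
  have "A 0 = A' 0"
  proof (rule isCont_eq_limit[where f=A])
    show "isCont A 0" using holomorphic_on_imp_continuous_on[OF A_holomorphic] open_spectral_domain \<Omega>0
      by (simp add: continuous_on_eq_continuous_at)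
    show "isCont A' 0" by (rule DERIV_isCont[OF dA'])
    show "\<forall>\<^sub>F l in at 0. A l = A' l"
      using eventually_at_in_open[OF open_spectral_domain \<Omega>0] by eventually_elim (auto simp: eq)
  qed
  then have eq': "A' l = A l" if "l \<in> \<Omega>" for l using eq[OF that] by (cases "l = 0") auto
  have "deriv A 0 = of_real (P - m) * (\<phi>1 X - \<phi>1 0)
      + (integral {0..X} h1 * (- of_real \<delta>) + of_real (c * (P - m)) * integral {0..X} (h 0))"
    by (rule DERIV_imp_deriv[OF has_field_derivative_transform_within_open[OF dA' open_spectral_domain \<Omega>0 eq']])
  moreover have "integral {0..X} (h 0) = of_real (P - m)"
  proof -
    have "integral {0..X} (h 0) = integral {0..X} (\<lambda>x. complex_of_real (H' x))"
      by (intro integral_cong) (simp add: h_0)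
    then show ?thesis
      using integral_unique[OF has_integral_of_real[OF integral_H'[OF X0(2)]]] by (simp add: HX)
  qed
  moreover obtain \<kappa> where \<kappa>: "\<And>x. x \<in> {0..X} \<Longrightarrow> h1 x = of_real (g x) + \<kappa> * of_real (H' x)"
    using h1_eq by blast
  moreover have "integral {0..X} h1 = of_real (integral {0..X} g) + \<kappa> * of_real (P - m)"
  proof -
    have "(g has_integral integral {0..X} g) {0..X}"
      unfolding g_def by (intro integrable_integral integrable_continuous_real continuous_intros
        continuous_H continuous_H')
    then have "((\<lambda>x. complex_of_real (g x) + \<kappa> * of_real (H' x)) has_integral
        of_real (integral {0..X} g) + \<kappa> * of_real (P - m)) {0..X}"
      using integral_H'[OF X0(2)] unfolding HX
      by (intro has_integral_add has_integral_mult_right has_integral_of_real)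
    then show ?thesis using \<kappa> integral_unique integral_cong by (metis (no_types, lifting))
  qed
  moreover have "\<phi>1 X - \<phi>1 0 = of_real (\<Phi> X - \<Phi> 0) + \<kappa> * of_real \<delta>"
  proof -
    have "\<phi>1 x = of_real (\<Phi> x) + \<kappa> * of_real (R (H x))" if x: "x \<in> {0..X}" for x
      unfolding \<phi>1_def \<kappa>[OF x] \<Phi>_eq[OF x] a_mult_H'[OF x, symmetric]
      by (simp only: of_real_add of_real_mult) (simp only: algebra_simps)
    then show ?thesis using X0 by (simp add: H0 HX \<delta>_def algebra_simps)
  qed
  ultimately have "deriv A 0 = of_real (P - m) * (of_real (\<Phi> X - \<Phi> 0) + \<kappa> * of_real \<delta>)
      + ((of_real (integral {0..X} g) + \<kappa> * of_real (P - m)) * (- of_real \<delta>)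
        + of_real (c * (P - m)) * of_real (P - m))" by simp
  \<comment> \<open>The two \<kappa> terms are opposite: one comes from the jump of the flux, the
    other from the integral of \<open>h1\<close>.\<close>
  also have "\<dots> = of_real ((P - m) * (\<Phi> X - \<Phi> 0) - integral {0..X} g * \<delta> + c * (P - m)^2)"
    by (simp add: algebra_simps power2_eq_square)
  \<comment> \<open>Here the terms with \<open>c\<close> and those with the position
    \<open>xs\<close> of the sonic point cancel as well.\<close>
  also have "(P - m) * (\<Phi> X - \<Phi> 0) - integral {0..X} g * \<delta> + c * (P - m)^2
      = \<beta> * (2 * mass * \<delta> + X * (P * R m - m * R P))"
    unfolding \<Phi>_jump integral_g \<delta>_def by (simp add: algebra_simps power2_eq_square)
  finally show ?thesis .
qed

end

end

section \<open>Modulation\<close>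

lemma eigenvalues_lower_triangular:
  fixes K :: "real^2^2"
  assumes "K$1$1 = x" "K$1$2 = 0" "K$2$2 = y"
  shows "{mu. \<exists>v :: complex^2. v \<noteq> 0 \<and> map_matrix complex_of_real K *v v = mu *s v}
    = {of_real x, of_real y}" (is "?S = _")
proof -
  have ev: "map_matrix complex_of_real K *v v = mu *s v \<longleftrightarrow>
      of_real x * v$1 = mu * v$1 \<and> of_real (K$2$1) * v$1 + of_real y * v$2 = mu * v$2" for mu v
    using assms by (simp add: vec_eq_iff forall_2 matrix_vector_mult_def sum_2)
  have nz: "v \<noteq> 0 \<longleftrightarrow> v$1 \<noteq> 0 \<or> v$2 \<noteq> 0" for v :: "complex^2" by (auto simp: vec_eq_iff forall_2)
  have "mu = of_real x \<or> mu = of_real y" if mu: "mu \<in> ?S" for mu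
  proof -
    obtain v :: "complex^2" where v: "v \<noteq> 0" "map_matrix complex_of_real K *v v = mu *s v"
      using mu by blast
    show ?thesis
    proof (cases "v$1 = 0")
      case True
      then have "v$2 \<noteq> 0" "of_real y * v$2 = mu * v$2" using v(1) v(2)[unfolded ev] nz[of v] by simp_all
      then show ?thesis by simp
    next
      case False
      then show ?thesis using v(2)[unfolded ev] by simp
    qed
  qed
  moreover have "of_real y \<in> ?S"
    by (intro CollectI exI[of _ "vector [0, 1]"]) (simp add: ev nz)
  \<comment> \<open>For distinct diagonal entries \<open>(x - y, K$2$1)\<close> is an eigenvector
    for \<open>x\<close>; for equal ones the eigenvalue has already been found.\<close>
  moreover have "of_real x \<in> ?S"
  proof (cases "x = y")
    case False
    then have "of_real x - of_real y \<noteq> (0::complex)" by simp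
    then show ?thesis
      by (intro CollectI exI[of _ "vector [of_real x - of_real y, of_real (K$2$1)]"])
        (auto simp: ev nz algebra_simps)
  qed (use \<open>of_real y \<in> ?S\<close> in simp)
  ultimately show ?thesis by blast
qed

text \<open>The vanishing second column of \<open>E\<close> passes to the inverse of
  \<open>M\<close> times \<open>E\<close>, and Cramer's rule gives the remaining diagonal entry.
  Taking \<open>c\<close> to be the wave speed treats the original frame, and \<open>c = 0\<close>
  with the same \<open>E\<close> the comoving one.\<close>

lemma characteristics_triangular:
  fixes M E :: "real^2^2"
  assumes G0: "(G0 has_derivative (*v) M) (at p)"
    and G1: "(G1 has_derivative (*v) (c *\<^sub>R M + E)) (at p)"
    and det: "det M \<noteq> 0" and E: "E$1$2 = 0" "E$2$2 = 0"
  shows "invertible (jacobian G0 (at p))"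
    "characteristics G0 G1 p = {of_real (c + (E$1$1 * M$2$2 - E$2$1 * M$1$2) / det M), of_real c}"
proof -
  have J: "jacobian G (at p) = N" if "(G has_derivative (*v) N) (at p)" for G N
    unfolding jacobian_def frechet_derivative_at[OF that, symmetric] by simp
  have inv: "invertible M" using det by (simp add: invertible_det_nz)
  then show "invertible (jacobian G0 (at p))" by (simp add: J[OF G0])
  have iM: "M ** matrix_inv M = mat 1" "matrix_inv M ** M = mat 1"
    using someI_ex[OF inv[unfolded invertible_def]] by (simp_all add: matrix_inv_def)
  define K where "K = matrix_inv M ** E"
  have MK: "M ** K = E"
    by (simp add: K_def matrix_mul_assoc iM)
  then have eqs: "M$i$1 * K$1$j + M$i$2 * K$2$j = E$i$j" for i j
    by (auto simp: matrix_matrix_mult_def vec_eq_iff sum_2)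
  have d: "det M = M$1$1 * M$2$2 - M$1$2 * M$2$1" by (simp add: det_2)
  have "det M * K$1$2 = 0" "det M * K$2$2 = 0"
    using eqs[of 1 2] eqs[of 2 2] E unfolding d by algebra+
  then have K2: "K$1$2 = 0" "K$2$2 = 0" using det by auto
  have "det M * K$1$1 = E$1$1 * M$2$2 - E$2$1 * M$1$2"
    using arg_cong[OF eqs[of 1 1], of "\<lambda>t. t * M$2$2"] arg_cong[OF eqs[of 2 1], of "\<lambda>t. t * M$1$2"]
    unfolding d by (simp add: algebra_simps)
  then have K1: "K$1$1 = (E$1$1 * M$2$2 - E$2$1 * M$1$2) / det M" using det by (simp add: field_simps)
  have "matrix_inv M ** (c *\<^sub>R M) = c *\<^sub>R (matrix_inv M ** M)"
    by (simp only: matrix_scalar_ac scalar_matrix_assoc)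
  then have "matrix_inv M ** (c *\<^sub>R M + E) = c *\<^sub>R mat 1 + K"
    by (simp only: matrix_add_ldistrib iM K_def)
  then show "characteristics G0 G1 p = {of_real (c + (E$1$1 * M$2$2 - E$2$1 * M$1$2) / det M), of_real c}"
    unfolding characteristics_def J[OF G0] J[OF G1]
    by (intro eigenvalues_lower_triangular) (simp_all add: K1 K2 mat_def)
qed

text \<open>The positive root \<open>x\<close> of \<open>x * y * (x + y) = 2\<close>, which is the
  jump condition at unit sonic height after removing the factor \<open>x - y\<close>.\<close>

definition height_ratio :: "real \<Rightarrow> real" where
  "height_ratio y = (sqrt (y^2 + 8 / y) - y) / 2"

lemma height_ratio:
  assumes "y > 0"
  shows "height_ratio y > 0" "height_ratio y * y * (height_ratio y + y) = 2"
proof -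
  have "y^2 < y^2 + 8 / y" using assms by simp
  then have "sqrt (y^2) < sqrt (y^2 + 8 / y)" by (rule real_sqrt_less_mono)
  then show "height_ratio y > 0" using assms by (simp add: height_ratio_def)
  have "(sqrt (y^2 + 8 / y))^2 = y^2 + 8 / y" using assms by (intro real_sqrt_pow2) simp
  moreover have "sqrt (y^2 + 8 / y) = 2 * height_ratio y + y" 
    by (simp add: height_ratio_def diff_divide_distrib)
  ultimately have "(2 * height_ratio y + y)^2 = y^2 + 8 / y" by simp
  then have "4 * (height_ratio y * (height_ratio y + y)) = 8 / y"
    by (simp add: power2_eq_square algebra_simps)
  then show "height_ratio y * y * (height_ratio y + y) = 2" using assms by (simp add: field_simps)
qed

lemma height_ratio_unique:
  assumes "y > 0" "x > 0" "x * y * (x + y) = 2"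
  shows "x = height_ratio y"
proof -
  have "y^2 + 8 / y = (2 * x + y)^2"
    using assms by (simp add: field_simps power2_eq_square)
  then have "sqrt (y^2 + 8 / y) = 2 * x + y" using assms by simp
  then show ?thesis by (simp add: height_ratio_def)
qed

text \<open>The relation between the derivatives comes from differentiating the jump condition
  at unit sonic height.\<close>

lemma height_ratio_deriv:
  assumes F: "F > 0" and y: "0 < y" "y < 1"
  obtains d where "(height_ratio has_real_derivative d) (at y)"
    "flux_deriv F 1 (height_ratio y) * d = flux_deriv F 1 y"
proof -
  have pos: "y^2 + 8 / y > 0" using y by (simp add: add_pos_pos)
  have "\<exists>d. (height_ratio has_real_derivative d) (at y)"
    unfolding height_ratio_def using y pos
    by (intro exI) (rule derivative_eq_intros refl | simp)+
  then obtain d where d: "(height_ratio has_real_derivative d) (at y)" by blast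
  define x where "x = height_ratio y"
  have x: "x > 0" "x * y * (x + y) = 2" using height_ratio[OF y(1)] by (auto simp: x_def)
  have "((\<lambda>y. height_ratio y * y * (height_ratio y + y)) has_real_derivative
      (d * y + x) * (x + y) + x * y * (d + 1)) (at y)"
    unfolding x_def by (auto intro!: derivative_eq_intros d simp: algebra_simps)
  moreover have "((\<lambda>y. height_ratio y * y * (height_ratio y + y)) has_real_derivative 0) (at y)"
    by (rule has_field_derivative_transform_within_open[OF DERIV_const open_greaterThan])
      (use y height_ratio(2) in auto)
  ultimately have "(d * y + x) * (x + y) + x * y * (d + 1) = 0" using DERIV_unique by blast
  then have e: "d * y * (2 * x + y) = - x * (x + 2 * y)" by (simp add: algebra_simps)
  \<comment> \<open>Replacing the constant 2 by \<open>x * y * (x + y)\<close> factors the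
    numerators of \<open>flux_deriv\<close> into the terms that occur in \<open>e\<close>.\<close>
  have cubes: "2 * (x^3 - 1) = x * (2 * x + y) * (x - y)" "2 * (y^3 - 1) = y * (x + 2 * y) * (y - x)"
    unfolding x(2)[symmetric] mult_2 power3_eq_cube right_diff_distrib mult_1_right
    using x(2) by (simp_all add: algebra_simps)
  have "2 * y^2 * (x^3 - 1) * d = x * y * (x - y) * (d * y * (2 * x + y))"
    using cubes(1) by algebra
  also have "\<dots> = x^2 * (y * (x + 2 * y) * (y - x))" unfolding e by algebra
  also have "\<dots> = 2 * x^2 * (y^3 - 1)" using cubes(2) by algebra
  finally have "y^2 * (x^3 - 1) * d = x^2 * (y^3 - 1)" by simp
  moreover have fd: "flux_deriv F 1 z = (z^3 - 1) / (F^2 * z^2)" if "z > 0" for z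
    unfolding flux_deriv_def q0_sq[OF zero_less_one] using that F
    by (simp add: field_simps power2_eq_square power3_eq_cube)
  moreover have "(x^3 - 1) * d / x^2 = (y^3 - 1) / y^2"
    using calculation(1) x(1) y(1) by (simp add: frac_eq_eq mult_ac)
  then have "(x^3 - 1) * d / x^2 / F^2 = (y^3 - 1) / y^2 / F^2" by simp
  ultimately have "flux_deriv F 1 x * d = flux_deriv F 1 y"
    by (simp add: fd[OF x(1)] fd[OF y(1)] mult.commute)
  then show thesis using that d by (simp add: x_def)
qed

lemma wave_slope_scale: "s > 0 \<Longrightarrow> wave_slope F s (s * y) = wave_slope F 1 y"
proof -
  assume s: "s > 0"
  have "wave_slope F s (s * y) = s^2 * (F^2 * y^2 - (2 * F + 1) * y + 1) / (s^2 * (y^2 + y + 1))"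
    unfolding wave_slope_def by (simp add: power2_eq_square algebra_simps)
  then show ?thesis using s by (simp add: wave_slope_def)
qed

lemma flux_deriv_scale: "F > 0 \<Longrightarrow> s > 0 \<Longrightarrow> y > 0 \<Longrightarrow> flux_deriv F s (s * y) = s * flux_deriv F 1 y"
  unfolding flux_deriv_def using q0_sq[of s F] q0_sq[of 1 F]
  by (simp add: power2_eq_square power3_eq_cube field_simps)

text \<open>The larger root of the numerator of \<open>wave_slope F 1\<close>, so the reciprocal
  slope is continuous beyond it.\<close>

definition min_ratio :: "real \<Rightarrow> real" where
  "min_ratio F = (1 + 2 * F + sqrt (1 + 4 * F)) / (2 * F^2)"

section \<open>Period and mass with the height as variable\<close>

context roll_wave_profile
begin

lemma min_ratio_less: "min_ratio F < m / s" "m / s < P / s"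
  using m_bound s ms sP by (auto simp: min_ratio_def field_simps)

lemma P_eq: "P = s * height_ratio (m / s)"
proof -
  have mP: "m > 0" "P > 0" "P \<noteq> m" using m sP s ms by auto
  have "k^2 * (1 / m - 1 / P) = (P^2 - m^2) / (2 * F^2)"
    using RH by (simp add: right_diff_distrib diff_divide_distrib)
  moreover have "1 / m - 1 / P = (P - m) / (P * m)" using mP by (simp add: field_simps)
  moreover have "P^2 - m^2 = (P + m) * (P - m)" by (simp add: power2_eq_square algebra_simps)
  ultimately have "k^2 * ((P - m) / (P * m)) = (P + m) * (P - m) / (2 * F^2)" by simp
  then have "k^2 / (P * m) * (P - m) = (P + m) / (2 * F^2) * (P - m)" by simp
  then have "k^2 / (P * m) = (P + m) / (2 * F^2)" using mP(3) by (simp only: mult_cancel_right) simp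
  then have "2 * F^2 * k^2 = (P + m) * (P * m)"
    using mP F by (simp add: frac_eq_eq mult_ac)
  then have "2 * s^3 = (P + m) * (P * m)" unfolding q0_sq[OF s] using F by simp
  then have "(P / s) * (m / s) * (P / s + m / s) = 2"
    using s by (simp add: field_simps power3_eq_cube)
  then have "P / s = height_ratio (m / s)"
    using s mP by (intro height_ratio_unique) auto
  then show ?thesis using s by (simp add: field_simps)
qed

text \<open>Substitution of \<open>y = H x / s\<close>, for which \<open>dx\<close> is
  \<open>s dy\<close> divided by the slope at unit sonic height. The constant \<open>f = 1\<close>
  yields the period, the identity the mass.\<close>

lemma scaled_antiderivative:
  assumes "\<And>y. y > min_ratio F \<Longrightarrow> (G has_real_derivative f y / wave_slope F 1 y) (at y)"
  shows "((\<lambda>x. f (H x / s)) has_integral s * (G (P / s) - G (m / s))) {0..X}"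
proof -
  have d: "((\<lambda>x. s * G (H x / s)) has_real_derivative f (H x / s)) (at x within {0..X})" if x: "x \<in> {0..X}" for x
  proof -
    have y: "H x / s > min_ratio F"
      using min_ratio_less(1) divide_right_mono[of m "H x" s] H_range[OF x] s by linarith
    have "H' x = wave_slope F 1 (H x / s)"
      using wave_slope_scale[OF s, of F "H x / s"] s by (simp add: H'_def)
    then have "wave_slope F 1 (H x / s) \<noteq> 0" "H' x = wave_slope F 1 (H x / s)" using H'_pos[OF x] by auto
    moreover have "((\<lambda>x. H x / s) has_real_derivative H' x / s) (at x within {0..X})"
      using s by (auto intro!: derivative_eq_intros H_deriv_within[OF x])
    then have "((\<lambda>x. s * G (H x / s)) has_real_derivative
        s * (f (H x / s) / wave_slope F 1 (H x / s) * (H' x / s))) (at x within {0..X})"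
      by (intro DERIV_cmult DERIV_chain2[where f=G and g="\<lambda>x. H x / s", OF assms[OF y]])
    ultimately show ?thesis using s by simp
  qed
  have "((\<lambda>x. f (H x / s)) has_integral (s * G (H X / s) - s * G (H 0 / s))) {0..X}"
    using X d by (intro fundamental_theorem_of_calculus)
      (auto simp: has_real_derivative_iff_has_vector_derivative)
  then show ?thesis by (simp add: H0 HX right_diff_distrib)
qed

lemma period_eq:
  assumes "\<And>y. y > min_ratio F \<Longrightarrow> (G has_real_derivative 1 / wave_slope F 1 y) (at y)"
  shows "X = s * (G (height_ratio (m / s)) - G (m / s))"
proof -
  have "((\<lambda>x. 1) has_integral s * (G (P / s) - G (m / s))) {0..X}"
    by (rule scaled_antiderivative) (rule assms)
  moreover have "((\<lambda>x. 1 :: real) has_integral X) {0..X}"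
    using has_integral_const_real[of "1::real" 0 X] X by simp
  ultimately have "X = s * (G (P / s) - G (m / s))" by (rule has_integral_unique[rotated])
  then show ?thesis using s by (simp add: P_eq)
qed

lemma mass_eq:
  assumes "\<And>y. y > min_ratio F \<Longrightarrow> (G has_real_derivative y / wave_slope F 1 y) (at y)"
  shows "mass = s^2 * (G (height_ratio (m / s)) - G (m / s))"
proof -
  have "((\<lambda>x. H x / s) has_integral s * (G (P / s) - G (m / s))) {0..X}"
    by (rule scaled_antiderivative[where f="\<lambda>y. y"]) (rule assms)
  then have "((\<lambda>x. s * (H x / s)) has_integral s * (s * (G (P / s) - G (m / s)))) {0..X}"
    by (rule has_integral_mult_right)
  then have "mass = s * (s * (G (P / s) - G (m / s)))"
    using s unfolding mass_def by (simp add: integral_unique)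
  then show ?thesis using s by (simp add: P_eq power2_eq_square)
qed

lemma mean_discharge_eq: "1 / X * integral {0..X} Q = c * (1 / X * mass) - k"
proof -
  have "(Q has_integral c * mass - k * X) {0..X}"
    unfolding discharge_def mass_def using has_integral_const_real[of k 0 X] X
    by (intro has_integral_diff has_integral_mult_right integrable_integral integrable_H) (simp add: mult.commute)
  then show ?thesis using X by (simp add: integral_unique field_simps)
qed

end

lemma slope_antiderivatives:
  assumes "F > 0"
  obtains G L where "\<And>y. y > min_ratio F \<Longrightarrow> (G has_real_derivative 1 / wave_slope F 1 y) (at y)"
    "\<And>y. y > min_ratio F \<Longrightarrow> (L has_real_derivative y / wave_slope F 1 y) (at y)"
proof -
  have nz: "wave_slope F 1 y \<noteq> 0" "y^2 + y + 1 \<noteq> 0" if "y > min_ratio F" for y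
    using wave_slope_pos[of F 1 y] that assms by (auto simp: min_ratio_def add_pos_pos less_imp_neq[THEN not_sym])
  have "\<exists>G. \<forall>y. ereal (min_ratio F) < y \<longrightarrow> y < \<infinity> \<longrightarrow> (G has_vector_derivative f y / wave_slope F 1 y) (at y)"
    if "f = (\<lambda>y. 1) \<or> f = (\<lambda>y. y)" for f :: "real \<Rightarrow> real"
  proof (rule einterval_antiderivative)
    show "isCont (\<lambda>y. f y / wave_slope F 1 y) y" if "ereal (min_ratio F) < y" for y :: real
      using nz[of y] \<open>f = _ \<or> _\<close> that unfolding wave_slope_def
      by (auto intro!: continuous_intros)
  qed simp
  from this[of "\<lambda>y. 1"] this[of "\<lambda>y. y"] show thesis
    using that by (auto simp: has_real_derivative_iff_has_vector_derivative)
qed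


section \<open>Differentiation in the wave parameters\<close>

lemma has_derivative_vector_2:
  fixes f g :: "'a::real_normed_vector \<Rightarrow> real"
  assumes "(f has_derivative f') F" "(g has_derivative g') F"
  shows "((\<lambda>x. vector [f x, g x] :: real^2) has_derivative (\<lambda>v. vector [f' v, g' v])) F"
proof -
  have e: "(vector [u, v] :: real^2) = u *\<^sub>R axis 1 1 + v *\<^sub>R axis 2 1" for u v
    by (simp add: vec_eq_iff forall_2 axis_def)
  show ?thesis unfolding e using assms by (auto intro!: derivative_eq_intros)
qed

lemma has_derivative_ratio:
  assumes "(f has_real_derivative d) (at (m / s))" "s \<noteq> 0"
  shows "((\<lambda>y::real^2. f (y$2 / y$1)) has_derivative (\<lambda>v. d * (v$2 / s - m / s^2 * v$1)))
    (at (vector [s, m]))"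
proof -
  have "((\<lambda>y::real^2. y$2 / y$1) has_derivative (\<lambda>v. v$2 / s - m / s^2 * v$1)) (at (vector [s, m]))"
    using assms(2) by (auto intro!: derivative_eq_intros bounded_linear_imp_has_derivative[OF bounded_linear_vec_nth]
      simp: field_simps power2_eq_square)
  moreover have "(f has_derivative (*) d) (at ((vector [s, m] :: real^2)$2 / (vector [s, m] :: real^2)$1))"
    using assms(1) by (simp add: has_field_derivative_def)
  ultimately show ?thesis by (rule has_derivative_compose)
qed

lemma has_derivative_vec_nth': "((\<lambda>y::real^2. y$i) has_derivative (\<lambda>v. v$i)) F"
  by (rule bounded_linear_imp_has_derivative[OF bounded_linear_vec_nth])

lemma speed_deriv:
  assumes "F > 0" "s > 0"
  shows "(speed F has_real_derivative (F + 1) / (2 * F * sqrt s)) (at s)"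
proof -
  have "((\<lambda>s. sqrt s * (1 + 1 / F)) has_real_derivative (1 + 1 / F) / (2 * sqrt s)) (at s)"
    using assms by (auto intro!: derivative_eq_intros simp: field_simps)
  then show ?thesis using assms unfolding speed_def[abs_def]
    by (elim back_subst[of "\<lambda>D. (_ has_real_derivative D) (at s)"]) (simp add: field_simps)
qed

text \<open>The product form exhibits \<open>k' = \<gamma> c'\<close>, the relation that also fixes
  \<gamma> in the eigenfunction.\<close>

lemma q0_deriv:
  assumes "F > 0" "s > 0"
  shows "(q0 F has_real_derivative 3 * s / (F + 1) * ((F + 1) / (2 * F * sqrt s))) (at s)"
proof -
  have "((\<lambda>s. s powr (3/2) / F) has_real_derivative (3 / 2 * s powr (1/2)) / F) (at s)"
    using assms by (auto intro!: derivative_eq_intros)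
  moreover have "(3 / 2 * s powr (1/2)) / F = 3 * s / (F + 1) * ((F + 1) / (2 * F * sqrt s))"
  proof -
    have "3 * s / (F + 1) * ((F + 1) / (2 * F * sqrt s)) = 3 * (s / sqrt s) / (2 * F)"
      using assms by simp
    also have "s / sqrt s = s powr (1/2)" using assms by (simp add: powr_half_sqrt real_div_sqrt)
    finally show ?thesis using assms by (simp add: field_simps)
  qed
  ultimately show ?thesis unfolding q0_def[abs_def] by simp
qed

text \<open>For fixed Froude number the waves are scaled copies of those with sonic height \<open>1\<close>, so the
  period and the mass are \<open>s \<Xi>(m / s)\<close> and \<open>s\<^sup>2 J(m / s)\<close>.\<close>

lemma scaled_modulation:
  fixes s m \<Xi>' J' F :: real and \<Xi> J :: "real \<Rightarrow> real"
    and X :: "real \<Rightarrow> real \<Rightarrow> real" and H :: "real \<Rightarrow> real \<Rightarrow> real \<Rightarrow> real"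
  defines "p \<equiv> vector [s, m] :: real^2" and "c' \<equiv> (F + 1) / (2 * F * sqrt s)"
  assumes F: "F > 0" and s: "s > 0" and U: "open U" "p \<in> U"
    and X: "\<And>y::real^2. y \<in> U \<Longrightarrow> X (y$1) (y$2) = y$1 * \<Xi> (y$2 / y$1)"
    and mean: "\<And>y::real^2. y \<in> U \<Longrightarrow> mean_height X H (y$1) (y$2) = y$1 * (J (y$2 / y$1) / \<Xi> (y$2 / y$1))"
    and disch: "\<And>y::real^2. y \<in> U \<Longrightarrow> mean_discharge F X H (y$1) (y$2)
        = speed F (y$1) * mean_height X H (y$1) (y$2) - q0 F (y$1)"
    and \<Xi>: "(\<Xi> has_real_derivative \<Xi>') (at (m / s))" and J: "(J has_real_derivative J') (at (m / s))"
    and pos: "\<Xi> (m / s) > 0" and nd: "J' * \<Xi> (m / s) \<noteq> 2 * J (m / s) * \<Xi>'"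
  defines "t \<equiv> \<Xi> (m / s) * (3 * s / (F + 1) * c' * \<Xi>' - s * c' * J') / (J' * \<Xi> (m / s) - 2 * J (m / s) * \<Xi>')"
  shows "whitham_density X H differentiable (at p)" "whitham_flux F X H differentiable (at p)"
    "invertible (jacobian (whitham_density X H) (at p))"
    "characteristics (whitham_density X H) (whitham_flux F X H) p = {of_real (speed F s + t), of_real (speed F s)}"
    "characteristics (whitham_density X H) (\<lambda>y. whitham_flux F X H y - speed F s *\<^sub>R whitham_density X H y) p
       = {of_real t, 0}"
proof -
  define \<mu> where "\<mu> = m / s"
  define j j' n n' where "j = J \<mu> / \<Xi> \<mu>" and "j' = (J' * \<Xi> \<mu> - J \<mu> * \<Xi>') / (\<Xi> \<mu>)^2"
    and "n = 1 / \<Xi> \<mu>" and "n' = - \<Xi>' / (\<Xi> \<mu>)^2"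
  have nz: "\<Xi> \<mu> \<noteq> 0" using pos by (simp add: \<mu>_def)
  have dj: "((\<lambda>y. J y / \<Xi> y) has_real_derivative j') (at (m / s))"
    using \<Xi> J nz unfolding j'_def \<mu>_def by (auto intro!: derivative_eq_intros simp: power2_eq_square)
  have dn: "((\<lambda>y. 1 / \<Xi> y) has_real_derivative n') (at (m / s))"
    using \<Xi> nz unfolding n'_def \<mu>_def by (auto intro!: derivative_eq_intros simp: power2_eq_square)
  define k0 where "k0 = 3 * s / (F + 1) * c'"
  have p1: "p$1 = s" "p$2 = m" by (simp_all add: p_def)
  have dc: "((\<lambda>y::real^2. speed F (y$1)) has_derivative (\<lambda>v. c' * v$1)) (at p)"
    using has_derivative_compose[OF has_derivative_vec_nth'[of 1 "at p"], of "speed F" "(*) c'"]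
      speed_deriv[OF F s] by (simp add: p1 has_field_derivative_def c'_def)
  have dq: "((\<lambda>y::real^2. q0 F (y$1)) has_derivative (\<lambda>v. k0 * v$1)) (at p)"
    using has_derivative_compose[OF has_derivative_vec_nth'[of 1 "at p"], of "q0 F" "(*) k0"]
      q0_deriv[OF F s] by (simp add: p1 has_field_derivative_def c'_def k0_def)
  define f1 f2 where "f1 = (\<lambda>y::real^2. y$1 * (J (y$2 / y$1) / \<Xi> (y$2 / y$1)))"
    and "f2 = (\<lambda>y::real^2. (1 / \<Xi> (y$2 / y$1)) / y$1)"
  have f2': "f2 y = 1 / (y$1 * \<Xi> (y$2 / y$1))" for y by (simp add: f2_def mult.commute)
  have dr: "(y has_derivative D) (at p)" if "(y has_derivative D') (at p)" "\<And>v. D' v = D v"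
    for y :: "real^2 \<Rightarrow> real" and D D'
    using that by (metis ext)
  have d1: "(f1 has_derivative (\<lambda>v. (j - \<mu> * j') * v$1 + j' * v$2)) (at p)"
    unfolding f1_def
    by (rule dr[OF has_derivative_mult[OF has_derivative_vec_nth' has_derivative_ratio[OF dj, folded p_def]]])
      (use s in \<open>auto simp: p1 j_def \<mu>_def field_simps power2_eq_square\<close>)
  have d2: "(f2 has_derivative (\<lambda>v. - (n + \<mu> * n') / s^2 * v$1 + n' / s^2 * v$2)) (at p)"
    unfolding f2_def
    by (rule dr[OF has_derivative_divide'[OF has_derivative_ratio[OF dn, folded p_def] has_derivative_vec_nth']])
      (use s in \<open>auto simp: p1 n_def \<mu>_def field_simps power2_eq_square\<close>)
  have f1p: "f1 p = s * j" "f2 p = n / s" by (simp_all add: f1_def f2_def p1 j_def n_def \<mu>_def)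
  \<comment> \<open>\<open>M\<close> is the Jacobian of the density. \<open>E\<close> collects the
    flux terms in which the derivative falls on the speed or on \<open>q0\<close>; these depend on
    \<open>s\<close> alone, hence the zero column.\<close>
  define M :: "real^2^2" where "M = vector [vector [j - \<mu> * j', j'], vector [- (n + \<mu> * n') / s^2, n' / s^2]]"
  define E :: "real^2^2" where "E = vector [vector [s * j * c' - k0, 0], vector [n / s * c', 0]]"
  have "((\<lambda>y. vector [f1 y, f2 y] :: real^2) has_derivative
      (\<lambda>v. vector [(j - \<mu> * j') * v$1 + j' * v$2, - (n + \<mu> * n') / s^2 * v$1 + n' / s^2 * v$2])) (at p)"
    by (rule has_derivative_vector_2[OF d1 d2])
  then have "((\<lambda>y. vector [f1 y, f2 y] :: real^2) has_derivative (*v) M) (at p)"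
    by (elim back_subst[of "\<lambda>D. (_ has_derivative D) (at p)"])
      (simp add: fun_eq_iff vec_eq_iff forall_2 matrix_vector_mult_def sum_2 M_def)
  then have G0: "(whitham_density X H has_derivative (*v) M) (at p)"
    by (rule has_derivative_transform_within_open[OF _ U])
      (simp add: whitham_density_def wave_number_def X mean f1_def f2')
  have "((\<lambda>y. vector [speed F (y$1) * f1 y - q0 F (y$1), speed F (y$1) * f2 y] :: real^2) has_derivative
      (\<lambda>v. vector [speed F s * ((j - \<mu> * j') * v$1 + j' * v$2) + c' * v$1 * (s * j) - k0 * v$1,
        speed F s * (- (n + \<mu> * n') / s^2 * v$1 + n' / s^2 * v$2) + c' * v$1 * (n / s)])) (at p)"
    using has_derivative_diff[OF has_derivative_mult[OF dc d1] dq] has_derivative_mult[OF dc d2]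
    unfolding p1 f1p by (rule has_derivative_vector_2)
  then have "((\<lambda>y. vector [speed F (y$1) * f1 y - q0 F (y$1), speed F (y$1) * f2 y] :: real^2)
      has_derivative (*v) (speed F s *\<^sub>R M + E)) (at p)"
    by (elim back_subst[of "\<lambda>D. (_ has_derivative D) (at p)"])
      (simp add: fun_eq_iff vec_eq_iff forall_2 matrix_vector_mult_def sum_2 M_def E_def algebra_simps)
  then have G1: "(whitham_flux F X H has_derivative (*v) (speed F s *\<^sub>R M + E)) (at p)"
    by (rule has_derivative_transform_within_open[OF _ U])
      (simp add: whitham_flux_def frequency_def wave_number_def X mean disch f1_def f2')
  have "((\<lambda>y. whitham_flux F X H y - speed F s *\<^sub>R whitham_density X H y) has_derivative
      (\<lambda>v. (speed F s *\<^sub>R M + E) *v v - speed F s *\<^sub>R (M *v v))) (at p)"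
    by (intro has_derivative_diff has_derivative_scaleR_right G0 G1)
  then have G2: "((\<lambda>y. whitham_flux F X H y - speed F s *\<^sub>R whitham_density X H y) has_derivative
      (*v) (0 *\<^sub>R M + E)) (at p)"
    by (elim back_subst[of "\<lambda>D. (_ has_derivative D) (at p)"])
      (simp add: fun_eq_iff matrix_vector_mult_add_rdistrib scaleR_matrix_vector_assoc)
  \<comment> \<open>This is the derivative of \<open>j n\<close>, that is of
    \<open>J / \<Xi>^2\<close>, the scale-invariant ratio of mass to squared period. The determinant
    of \<open>M\<close> is this derivative divided by \<open>s^2\<close>.\<close>
  have jn: "j * n' + j' * n = (J' * \<Xi> \<mu> - 2 * J \<mu> * \<Xi>') / (\<Xi> \<mu>)^3"
    unfolding j_def j'_def n_def n'_def using nz by (simp add: field_simps power2_eq_square power3_eq_cube)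
  have "det M = (j * n' + j' * n) / s^2"
    unfolding det_2 M_def vector_2 using s by (simp add: field_simps)
  then have detM: "det M = (J' * \<Xi> \<mu> - 2 * J \<mu> * \<Xi>') / (\<Xi> \<mu>)^3 / s^2" unfolding jn .
  have nd': "J' * \<Xi> \<mu> - 2 * J \<mu> * \<Xi>' \<noteq> 0" using nd by (simp add: \<mu>_def)
  have "E$1$1 * M$2$2 - E$2$1 * M$1$2 = (s * c' * (j * n' - n * j') - k0 * n') / s^2"
    unfolding M_def E_def vector_2 using s by (simp add: field_simps power2_eq_square)
  also have "j * n' - n * j' = - J' / (\<Xi> \<mu>)^2"
    unfolding j_def j'_def n_def n'_def using nz by (simp add: field_simps power2_eq_square)
  also have "(s * c' * (- J' / (\<Xi> \<mu>)^2) - k0 * n') / s^2 = (k0 * \<Xi>' - s * c' * J') / (\<Xi> \<mu>)^2 / s^2"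
    unfolding n'_def by (simp add: diff_divide_distrib)
  finally have num: "E$1$1 * M$2$2 - E$2$1 * M$1$2 = (k0 * \<Xi>' - s * c' * J') / (\<Xi> \<mu>)^2 / s^2" .
  have t: "(E$1$1 * M$2$2 - E$2$1 * M$1$2) / det M = t"
    unfolding num detM t_def k0_def[symmetric] \<mu>_def[symmetric] using nz s nd'
    by (simp add: field_simps power2_eq_square power3_eq_cube)
  have det0: "det M \<noteq> 0" using nd' nz s by (simp add: detM)
  have E2: "E$1$2 = 0" "E$2$2 = 0" by (simp_all add: E_def)
  show "whitham_density X H differentiable (at p)" "whitham_flux F X H differentiable (at p)"
    using G0 G1 differentiableI by blast+
  show "invertible (jacobian (whitham_density X H) (at p))"
    by (rule characteristics_triangular(1)[OF G0 G1 det0 E2])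
  show "characteristics (whitham_density X H) (whitham_flux F X H) p = {of_real (speed F s + t), of_real (speed F s)}"
    using characteristics_triangular(2)[OF G0 G1 det0 E2] by (simp only: t)
  show "characteristics (whitham_density X H) (\<lambda>y. whitham_flux F X H y - speed F s *\<^sub>R whitham_density X H y) p
       = {of_real t, 0}"
    using characteristics_triangular(2)[OF G0 G2 det0 E2] by (simp add: t)
qed

section \<open>Comparison of modulation and determinant\<close>

context roll_wave_profile
begin

text \<open>The relation for \<open>d\<close> says \<open>a P * d = a m\<close>. With
  \<open>R = a\<close> times the slope at both ends, it eliminates \<open>d\<close> and leaves
  source values only.\<close>

lemma modulation_derivatives:
  fixes d :: real
  assumes d: "flux_deriv F 1 (P / s) * d = flux_deriv F 1 (m / s)"
  defines "\<Xi>' \<equiv> d / wave_slope F 1 (P / s) - 1 / wave_slope F 1 (m / s)"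
    and "J' \<equiv> P / s * d / wave_slope F 1 (P / s) - m / s / wave_slope F 1 (m / s)"
  shows "R P * R m * \<Xi>' = - a m * \<delta>" "R P * R m * (s * J') = a m * (P * R m - m * R P)"
proof -
  have P: "P > 0" using sP s by simp
  have S: "wave_slope F 1 (P / s) = wave_slope F s P" "wave_slope F 1 (m / s) = wave_slope F s m"
    using wave_slope_scale[OF s, of F "P / s"] wave_slope_scale[OF s, of F "m / s"] s by simp_all
  have "a P = s * flux_deriv F 1 (P / s)" "a m = s * flux_deriv F 1 (m / s)"
    using flux_deriv_scale[OF _ s, of F "P / s"] flux_deriv_scale[OF _ s, of F "m / s"] s P m F by simp_all
  then have aP: "a P * d = a m" using d by simp
  have R: "R P = a P * wave_slope F s P" "R m = a m * wave_slope F s m"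
    using flux_deriv_mult_slope[OF _ s] P m F by simp_all
  define u v where "u = 1 / wave_slope F s P" and "v = 1 / wave_slope F s m"
  have uv: "wave_slope F s P * u = 1" "wave_slope F s m * v = 1"
    using wave_slope_P wave_slope_m by (simp_all add: u_def v_def)
  have "\<Xi>' = d * u - v" "s * J' = P * d * u - m * v"
    using s by (simp_all add: \<Xi>'_def J'_def S u_def v_def right_diff_distrib)
  then show "R P * R m * \<Xi>' = - a m * \<delta>" "R P * R m * (s * J') = a m * (P * R m - m * R P)"
    using aP uv unfolding \<delta>_def R by algebra+
qed

end

theorem corollary1p10:
  fixes F Hs Hm xs :: real
    and Hp X :: "real \<Rightarrow> real \<Rightarrow> real"
    and H :: "real \<Rightarrow> real \<Rightarrow> real \<Rightarrow> real"
    and h q :: "complex \<Rightarrow> real \<Rightarrow> complex"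
    and Dhat :: "complex \<Rightarrow> real \<Rightarrow> complex"
  defines "c \<equiv> speed F Hs"
    and "p \<equiv> (vector [Hs, Hm] :: real^2)"
    and "Delta \<equiv> evans_lopatinsky F Hs (X Hs Hm) (H Hs Hm) h q"
    and "G0 \<equiv> whitham_density X H"
    and "G1 \<equiv> whitham_flux F X H"
    and "alpha \<equiv> vector_derivative (\<lambda>xi. Dhat 0 xi) (at 0) / (\<i> * deriv (\<lambda>lam. Dhat lam 0) 0)"
  assumes "F > 2"
    and waves: "\<And>s m. wave_params F s m \<Longrightarrow> roll_wave F s m (Hp s m) (X s m) (H s m)"
    and wave: "wave_params F Hs Hm"
    and sonic: "0 < xs" "xs < X Hs Hm" "H Hs Hm xs = Hs"
    and sol: "normalized_solutions F Hs (X Hs Hm) (H Hs Hm) xs h q"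
    and Dhat: "is_reduced_determinant F Hs (X Hs Hm) Delta Dhat"
    and double: "double_root (\<lambda>lam. Delta lam 0) 0"
  shows "G0 differentiable (at p) \<and> G1 differentiable (at p) \<and> invertible (jacobian G0 (at p)) \<and>
         characteristics G0 G1 p = {of_real c + alpha, of_real c} \<and>
         characteristics G0 (\<lambda>y. G1 y - c *\<^sub>R G0 y) p = {alpha, 0} \<and>
         (\<exists>lam1 lam2. two_roots_near_0 Delta lam1 lam2 \<and>
            (\<lambda>xi. lam1 xi - (- \<i> * of_real xi * alpha)) \<in> O[at 0](\<lambda>xi. of_real (xi^2)) \<and>
            (\<forall>xi. lam2 xi = 0))"
proof -
  have prof: "roll_wave_profile F s m (Hp s m) (X s m) (H s m)" if "wave_params F s m" for s m
    using waves[OF that] \<open>F > 2\<close> by unfold_locales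
  interpret evans F Hs Hm "Hp Hs Hm" "X Hs Hm" "H Hs Hm" xs h q
    using prof[OF wave] sonic sol by (intro evans.intro evans_axioms.intro)
  note Dhat' = Dhat[unfolded Delta_def]
  define AA BB where "AA = A Dhat" and "BB = B Dhat"
  define P T where "P = Hp Hs Hm" and "T = X Hs Hm"
  have hol: "AA holomorphic_on spectral_domain F Hs" "BB holomorphic_on spectral_domain F Hs"
    unfolding AA_def BB_def using A_holomorphic[OF Dhat'] B_holomorphic[OF Dhat'] .
  have split: "Delta l xi = l * (AA l + (1 - exp (\<i> * of_real (xi * T))) * BB l)"
    if "l \<in> spectral_domain F Hs" for l xi
    unfolding Delta_def AA_def BB_def T_def by (rule evans_lopatinsky_split[OF Dhat' that])
  have A0: "AA 0 = 0" and A1: "deriv AA 0 \<noteq> 0"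
    using double_root_deriv_cofactor[OF open_spectral_domain \<Omega>0 hol(1) _ double] split[of _ 0] by auto
  have AA: "AA = (\<lambda>l. Dhat l 0)" by (simp add: AA_def A_def[OF Dhat'] fun_eq_iff)
  have alpha: "alpha = - of_real T * BB 0 / deriv AA 0"
  proof -
    \<comment> \<open>The reduced determinant is prescribed on the interval from
      \<open>- pi / T\<close> to \<open>pi / T\<close>, which contains a neighbourhood of 0, enough
      for the derivative.\<close>
    have ev: "\<forall>\<^sub>F xi in nhds 0. Dhat 0 xi = AA 0 + (1 - exp (\<i> * of_real (xi * T))) * BB 0"
    proof -
      have "\<forall>\<^sub>F xi in nhds 0. xi \<in> {- pi / T<..<pi / T}"
        using X by (intro eventually_nhds_in_open) (auto simp: T_def)
      then show ?thesis
        by eventually_elim (unfold AA_def BB_def T_def, rule Dhat_0_eq[OF Dhat'], auto)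
    qed
    have "((\<lambda>xi. AA 0 + (1 - exp (\<i> * of_real (xi * T))) * BB 0) has_vector_derivative
        - (\<i> * of_real T) * BB 0) (at 0)"
    proof -
      have "((\<lambda>z. AA 0 + (1 - exp (\<i> * (z * of_real T))) * BB 0) has_field_derivative
          - (\<i> * of_real T) * BB 0) (at (of_real 0))"
        by (auto intro!: derivative_eq_intros)
      then have "((\<lambda>z. AA 0 + (1 - exp (\<i> * (of_real z * of_real T))) * BB 0) has_vector_derivative
          - (\<i> * of_real T) * BB 0) (at 0)"
        by (rule has_vector_derivative_real_field)
      then show ?thesis by simp
    qed
    then have "vector_derivative (\<lambda>xi. AA 0 + (1 - exp (\<i> * of_real (xi * T))) * BB 0) (at 0)
        = - (\<i> * of_real T) * BB 0"
      by (rule vector_derivative_at)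
    then have "vector_derivative (\<lambda>xi. Dhat 0 xi) (at 0) = - (\<i> * of_real T) * BB 0"
      using vector_derivative_cong_eq[where f="\<lambda>xi. Dhat 0 xi" and x=0 and y=0 and A=UNIV and B=UNIV
          and g="\<lambda>xi. AA 0 + (1 - exp (\<i> * of_real (xi * T))) * BB 0"] ev by simp
    then show ?thesis unfolding alpha_def AA[symmetric] by simp
  qed
  have roots: "\<exists>lam1 lam2. two_roots_near_0 Delta lam1 lam2 \<and>
      (\<lambda>xi. lam1 xi - (- \<i> * of_real xi * alpha)) \<in> O[at 0](\<lambda>xi. of_real (xi^2)) \<and> (\<forall>xi. lam2 xi = 0)"
    unfolding alpha by (rule roots_of_affine_perturbation[OF open_spectral_domain \<Omega>0 hol A0 A1 split])

  obtain G L where G: "\<And>y. y > min_ratio F \<Longrightarrow> (G has_real_derivative 1 / wave_slope F 1 y) (at y)"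
    and L: "\<And>y. y > min_ratio F \<Longrightarrow> (L has_real_derivative y / wave_slope F 1 y) (at y)"
    using slope_antiderivatives[of F] \<open>F > 2\<close> by auto
  \<comment> \<open>Period and mass of the wave of unit sonic height and minimal height
    \<open>y\<close>.\<close>
  define \<Xi> where "\<Xi> y = G (height_ratio y) - G y" for y
  define J where "J y = L (height_ratio y) - L y" for y
  define \<mu> where "\<mu> = Hm / Hs"
  have P: "P / Hs = height_ratio \<mu>" using P_eq s by (simp add: P_def \<mu>_def)
  have \<mu>: "min_ratio F < \<mu>" "\<mu> < 1" "0 < \<mu>" "\<mu> < height_ratio \<mu>"
    using min_ratio_less s m ms unfolding P_def[symmetric] P by (auto simp: \<mu>_def)
  obtain d where d: "(height_ratio has_real_derivative d) (at \<mu>)"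
    "flux_deriv F 1 (height_ratio \<mu>) * d = flux_deriv F 1 \<mu>"
    using height_ratio_deriv[of F \<mu>] \<open>F > 2\<close> \<mu> by auto
  define \<Xi>' where "\<Xi>' = d / wave_slope F 1 (height_ratio \<mu>) - 1 / wave_slope F 1 \<mu>"
  define J' where "J' = height_ratio \<mu> * d / wave_slope F 1 (height_ratio \<mu>) - \<mu> / wave_slope F 1 \<mu>"
  have \<rho>: "height_ratio \<mu> > min_ratio F" using \<mu> by linarith
  have dX: "(\<Xi> has_real_derivative \<Xi>') (at (Hm / Hs))"
    using DERIV_diff[OF DERIV_chain2[where f=G and g=height_ratio, OF G[OF \<rho>] d(1)] G[OF \<mu>(1)]]
    by (simp add: \<Xi>_def[abs_def] \<Xi>'_def \<mu>_def)
  have dJ: "(J has_real_derivative J') (at (Hm / Hs))"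
    using DERIV_diff[OF DERIV_chain2[where f=L and g=height_ratio, OF L[OF \<rho>] d(1)] L[OF \<mu>(1)]]
    by (simp add: J_def[abs_def] J'_def \<mu>_def)
  \<comment> \<open>Jacobians need the scaling formulas on a neighbourhood of \<open>p\<close>; the
    admissible parameters form an open set since all conditions are strict.\<close>
  define U :: "(real^2) set" where "U = {y. wave_params F (y$1) (y$2)}"
  have U_eq: "U = {y. 0 < y$1} \<inter> {y. min_ratio F * y$1 < y$2} \<inter> {y. y$2 < y$1}"
    by (auto simp: U_def wave_params_def min_ratio_def)
  have U: "open U" "p \<in> U"
    using wave by (auto simp: U_eq intro!: open_Int open_Collect_less continuous_intros)
      (auto simp: p_def wave_params_def min_ratio_def)
  have period: "X s m = s * \<Xi> (m / s)" and mean: "mean_height X H s m = s * (J (m / s) / \<Xi> (m / s))"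
    and disch: "mean_discharge F X H s m = speed F s * mean_height X H s m - q0 F s"
    if "wave_params F s m" for s m
  proof -
    interpret W: roll_wave_profile F s m "Hp s m" "X s m" "H s m" by (rule prof[OF that])
    show 1: "X s m = s * \<Xi> (m / s)" unfolding \<Xi>_def by (rule W.period_eq[OF G])
    have M: "integral {0..X s m} (H s m) = s^2 * J (m / s)"
      unfolding J_def W.mass_def[symmetric] by (rule W.mass_eq[OF L])
    show "mean_height X H s m = s * (J (m / s) / \<Xi> (m / s))"
      unfolding mean_height_def M unfolding 1 using W.s by (simp add: power2_eq_square)
    show "mean_discharge F X H s m = speed F s * mean_height X H s m - q0 F s"
      unfolding mean_discharge_def mean_height_def by (rule W.mean_discharge_eq[unfolded W.mass_def])
  qed
  have TX: "T = Hs * \<Xi> \<mu>" using period[OF wave] by (simp add: T_def \<mu>_def)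
  have massJ: "mass = Hs^2 * J \<mu>" unfolding J_def \<mu>_def by (rule mass_eq[OF L])
  have pos: "\<Xi> \<mu> > 0" using TX X s by (simp add: T_def zero_less_mult_iff)

  define Rp Rm am where "Rp = source F Hs P" and "Rm = source F Hs Hm" and "am = flux_deriv F Hs Hm"
  have rel: "Rp * Rm * \<Xi>' = - am * \<delta>" "Rp * Rm * (Hs * J') = am * (P * Rm - Hm * Rp)"
    using modulation_derivatives[of d] d(2)
    unfolding Rp_def Rm_def am_def \<Xi>'_def J'_def P_def[symmetric] P \<mu>_def[symmetric] by simp_all
  have RR: "Rp * Rm \<noteq> 0" "am \<noteq> 0"
  proof -
    have "flux_deriv F Hs P \<noteq> 0" "am \<noteq> 0"
      using flux_deriv_eq_0_iff[OF _ s] m ms sP s \<open>F > 2\<close> unfolding P_def am_def by auto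
    moreover have "Rp = flux_deriv F Hs P * wave_slope F Hs P" "Rm = am * wave_slope F Hs Hm"
      using flux_deriv_mult_slope[OF _ s] m sP s \<open>F > 2\<close> unfolding P_def am_def Rp_def Rm_def by auto
    ultimately show "Rp * Rm \<noteq> 0" "am \<noteq> 0" using wave_slope_P wave_slope_m by (auto simp: P_def)
  qed
  have B0: "BB 0 = of_real (P * Rm - Hm * Rp + \<gamma> * \<delta>)"
    unfolding BB_def P_def Rm_def Rp_def by (rule B_0[OF Dhat'])
  have dA: "deriv AA 0 = of_real (\<beta> * (2 * mass * \<delta> + T * (P * Rm - Hm * Rp)))"
    unfolding AA_def P_def Rm_def Rp_def T_def by (rule deriv_A_0[OF Dhat'])
  define N where "N = J' * \<Xi> \<mu> - 2 * J \<mu> * \<Xi>'"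
  have "am * (2 * mass * \<delta> + T * (P * Rm - Hm * Rp)) = Rp * Rm * (Hs^2 * N)"
    unfolding massJ TX N_def using rel by algebra
  then have e1: "2 * mass * \<delta> + T * (P * Rm - Hm * Rp) = Rp * Rm * (Hs^2 * N) / am"
    using RR(2) by (simp add: field_simps)
  have "am * (P * Rm - Hm * Rp + \<gamma> * \<delta>) = Rp * Rm * (Hs * J' - \<gamma> * \<Xi>')"
    using rel by algebra
  then have e2: "P * Rm - Hm * Rp + \<gamma> * \<delta> = Rp * Rm * (Hs * J' - \<gamma> * \<Xi>') / am"
    using RR(2) by (simp add: field_simps)
  \<comment> \<open>Here the exact multiplicity reaches the Whitham side: a nonzero derivative of
    the reduced determinant makes the density Jacobian invertible.\<close>
  have N: "N \<noteq> 0" using A1 unfolding dA e1 by auto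
  define c' where "c' = (F + 1) / (2 * F * sqrt Hs)"
  \<comment> \<open>This matches the scaling \<open>- 1 / c'\<close> of the generalized
    eigenfunction with the derivative of the speed in the Whitham flux.\<close>
  have c': "Hs * c' * \<beta> = 1"
  proof -
    have "F + 1 \<noteq> 0" "F \<noteq> 0" using \<open>F > 2\<close> by auto
    then have "c' * \<beta> = 1 / (sqrt Hs * sqrt Hs)" unfolding c'_def \<beta>_def by (simp add: frac_eq_eq)
    then show ?thesis using s by (simp add: mult.assoc)
  qed
  define t where "t = \<Xi> \<mu> * (3 * Hs / (F + 1) * c' * \<Xi>' - Hs * c' * J') / (J' * \<Xi> \<mu> - 2 * J \<mu> * \<Xi>')"
  have "alpha = of_real (- T * (Rp * Rm * (Hs * J' - \<gamma> * \<Xi>') / am) / (\<beta> * (Rp * Rm * (Hs^2 * N) / am)))"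
    unfolding alpha B0 dA e1 e2 by simp
  also have "- T * (Rp * Rm * (Hs * J' - \<gamma> * \<Xi>') / am) / (\<beta> * (Rp * Rm * (Hs^2 * N) / am))
      = \<Xi> \<mu> * (\<gamma> * \<Xi>' - Hs * J') / (\<beta> * Hs * N)"
    using RR N s \<beta>_pos unfolding TX by (simp add: field_simps power2_eq_square)
  also have "\<dots> = \<Xi> \<mu> * (\<gamma> * \<Xi>' - Hs * J') * (Hs * c' * \<beta>) / (\<beta> * Hs * N)" using c' by simp
  also have "\<dots> = t"
    using N s \<beta>_pos unfolding t_def \<gamma>_def[symmetric] N_def[symmetric] by (simp add: field_simps)
  finally have alpha_t: "alpha = of_real t" .

  have nd: "J' * \<Xi> (Hm / Hs) \<noteq> 2 * J (Hm / Hs) * \<Xi>'" using N by (simp add: N_def \<mu>_def)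
  have pos': "\<Xi> (Hm / Hs) > 0" using pos by (simp add: \<mu>_def)
  have F0: "F > 0" using \<open>F > 2\<close> by simp
  note mod = scaled_modulation[OF F0 s U[unfolded p_def] _ _ _ dX dJ pos' nd,
      folded p_def c'_def \<mu>_def, folded t_def]
  show ?thesis
    unfolding G0_def G1_def alpha_t c_def
    using mod[of X H] period mean disch roots[unfolded alpha_t] by (auto simp: U_def)
qed

end
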